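(* Let $A$ be a $C^*$-algebra with a strictly positive element (in particular, $A$ may be any separable $C^*$-algebra), regarded as a right Hilbert module over itself. Then $A$ has the module Schur property if and only if $A$ is unital. In particular, the (Banach space) Schur property for $C^*$-algebras is strictly stronger than the module Schur property.
   Context: A $C^*$-algebra $A$ is a right Hilbert $A$-module over itself with inner product $\langle a,b\rangle=a^*b$. For a Hilbert $A$-module $V$, the topology $\tau_{\widehat V}$ on $V$ is the locally convex topology generated by the seminorms $x\mapsto\|\langle z,x\rangle\|$, $z\in V$. A sequence $\{x_n\}$ in $V$ is called $\tau_{\widehat V}$-convergent if for every $z\in V$ the sequence $\{\langle z,x_n\rangle\}$ converges in norm in $A$ (so the limit may lie in the completion of $V$ with respect to $\tau_{\widehat V}$, not necessarily in $V$). $V$ has the module Schur property if every $\tau_{\widehat V}$-convergent sequence in $V$ converges in norm (to an element of $V$). A Banach space $X$ has the Schur property if every weakly convergent sequence in $X$ converges in norm. "Strictly stronger" means: every $C^*$-algebra with the Schur property has the module Schur property (as a Hilbert module over itself), but not conversely. *)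

theory Defs
  imports "HOL-Analysis.Analysis"
begin

section \<open>Complex Banach spaces and the Schur property\<close>

class complex_vector = real_vector +
  fixes scaleC :: "complex \<Rightarrow> 'a \<Rightarrow> 'a"  (infixr \<open>*\<^sub>C\<close> 75)
  assumes scaleC_add_right: "a *\<^sub>C (x + y) = a *\<^sub>C x + a *\<^sub>C y"
    and scaleC_add_left: "(a + b) *\<^sub>C x = a *\<^sub>C x + b *\<^sub>C x"
    and scaleC_scaleC: "a *\<^sub>C (b *\<^sub>C x) = (a * b) *\<^sub>C x"
    and scaleR_scaleC: "r *\<^sub>R x = complex_of_real r *\<^sub>C x"

class complex_normed_vector = complex_vector + real_normed_vector +
  assumes norm_scaleC: "norm (a *\<^sub>C x) = cmod a * norm x"

class complex_banach = complex_normed_vector + banach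

definition bounded_clinear_functional :: "('x::complex_normed_vector \<Rightarrow> complex) \<Rightarrow> bool" where
  "bounded_clinear_functional f \<longleftrightarrow> bounded_linear f \<and> (\<forall>c x. f (c *\<^sub>C x) = c * f x)"

definition weakly_tendsto :: "(nat \<Rightarrow> 'x::complex_normed_vector) \<Rightarrow> 'x \<Rightarrow> bool" where
  "weakly_tendsto x l \<longleftrightarrow>
     (\<forall>f. bounded_clinear_functional f \<longrightarrow> (\<lambda>n. f (x n)) \<longlonglongrightarrow> f l)"

definition schur_property :: "'x::complex_banach itself \<Rightarrow> bool" where
  "schur_property _ \<longleftrightarrow>
     (\<forall>(x :: nat \<Rightarrow> 'x) l. weakly_tendsto x l \<longrightarrow> convergent x)"


section \<open>C*-algebras\<close>

text \<open>A unit is not assumed: \<^class>\<open>real_normed_algebra\<close> is the class of associative, not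
  necessarily unital, normed algebras. The zero algebra is allowed.\<close>

class cstar_algebra = complex_banach + real_normed_algebra +
  fixes star :: "'a \<Rightarrow> 'a"
  assumes mult_scaleC_left: "(c *\<^sub>C x) * y = c *\<^sub>C (x * y)"
    and mult_scaleC_right: "x * (c *\<^sub>C y) = c *\<^sub>C (x * y)"
    and star_star: "star (star x) = x"
    and star_add: "star (x + y) = star x + star y"
    and star_scaleC: "star (c *\<^sub>C x) = cnj c *\<^sub>C star x"
    and star_mult: "star (x * y) = star y * star x"
    and norm_star_mult_self: "norm (star x * x) = (norm x)\<^sup>2"

definition unital_algebra :: "'a::cstar_algebra itself \<Rightarrow> bool" where
  "unital_algebra _ \<longleftrightarrow> (\<exists>e::'a. \<forall>a. e * a = a \<and> a * e = a)"

definition positive_element :: "'a::cstar_algebra \<Rightarrow> bool" where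
  "positive_element a \<longleftrightarrow> (\<exists>b. a = star b * b)"

text \<open>A state is a positive linear functional of norm one, where \<^term>\<open>onorm\<close> is the
  operator norm.\<close>

definition state :: "('a::cstar_algebra \<Rightarrow> complex) \<Rightarrow> bool" where
  "state \<phi> \<longleftrightarrow> bounded_clinear_functional \<phi> \<and>
     (\<forall>a. positive_element a \<longrightarrow> \<phi> a \<in> \<real>\<^sub>\<ge>\<^sub>0) \<and> onorm \<phi> = 1"

text \<open>For a positive element \<^term>\<open>h\<close> and a state \<^term>\<open>\<phi>\<close> the number \<^term>\<open>\<phi> h\<close> is real,
  so that the last condition below says \<open>\<phi>(h) > 0\<close>.\<close>

definition strictly_positive :: "'a::cstar_algebra \<Rightarrow> bool" where
  "strictly_positive h \<longleftrightarrow> positive_element h \<and> (\<forall>\<phi>. state \<phi> \<longrightarrow> 0 < Re (\<phi> h))"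


section \<open>Hilbert modules and the module Schur property\<close>

text \<open>Completeness of the module is part of \<^class>\<open>complex_banach\<close>, and definiteness of the
  inner product is contained in \<open>norm_ip\<close>.\<close>

locale hilbert_module =
  fixes act :: "'v::complex_banach \<Rightarrow> 'a::cstar_algebra \<Rightarrow> 'v"
    and ip :: "'v \<Rightarrow> 'v \<Rightarrow> 'a"
  assumes act_add_left: "act (x + y) a = act x a + act y a"
    and act_add_right: "act x (a + b) = act x a + act x b"
    and act_mult: "act x (a * b) = act (act x a) b"
    and act_scaleC_left: "act (c *\<^sub>C x) a = c *\<^sub>C act x a"
    and act_scaleC_right: "act x (c *\<^sub>C a) = c *\<^sub>C act x a"
    and ip_add_right: "ip x (y + z) = ip x y + ip x z"
    and ip_scaleC_right: "ip x (c *\<^sub>C y) = c *\<^sub>C ip x y"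
    and ip_act_right: "ip x (act y a) = ip x y * a"
    and star_ip: "star (ip x y) = ip y x"
    and ip_positive: "positive_element (ip x x)"
    and norm_ip: "(norm x)\<^sup>2 = norm (ip x x)"

text \<open>The following notions depend on a Hilbert module only through its inner product. The
  limits of \<open>\<langle>z, x\<^sub>n\<rangle>\<close> are not required to be of the form \<open>\<langle>z, x\<rangle>\<close>:
  a \<open>\<tau>\<close>-convergent sequence may have its limit outside the module.\<close>

definition tau_convergent ::
  "('v::complex_banach \<Rightarrow> 'v \<Rightarrow> 'a::cstar_algebra) \<Rightarrow> (nat \<Rightarrow> 'v) \<Rightarrow> bool" where
  "tau_convergent ip x \<longleftrightarrow> (\<forall>z. convergent (\<lambda>n. ip z (x n)))"

definition module_schur_property ::
  "('v::complex_banach \<Rightarrow> 'v \<Rightarrow> 'a::cstar_algebra) \<Rightarrow> bool" where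
  "module_schur_property ip \<longleftrightarrow> (\<forall>x. tau_convergent ip x \<longrightarrow> convergent x)"

definition self_ip :: "'a::cstar_algebra \<Rightarrow> 'a \<Rightarrow> 'a" where
  "self_ip a b = star a * b"

interpretation self_module: hilbert_module "(*) :: 'a::cstar_algebra \<Rightarrow> 'a \<Rightarrow> 'a" self_ip
  by standard
    (auto simp: self_ip_def positive_element_def algebra_simps mult_scaleC_left mult_scaleC_right
      star_mult star_star norm_star_mult_self)


section \<open>Bounded continuous functions form a C*-algebra\<close>

instantiation complex :: cstar_algebra
begin

definition scaleC_complex :: "complex \<Rightarrow> complex \<Rightarrow> complex" where
  "scaleC_complex c z = c * z"

definition star_complex :: "complex \<Rightarrow> complex" where
  "star_complex z = cnj z"

instance
  by standard
    (auto simp: scaleC_complex_def star_complex_def algebra_simps norm_mult power2_eq_square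
      scaleR_conv_of_real)

end

lemma norm_star: "norm (star x) = norm (x::'a::cstar_algebra)"
proof -
  have le: "norm y \<le> norm (star y)" for y :: 'a
  proof (cases "norm y = 0")
    case False
    have "norm y * norm y = norm (star y * y)"
      by (simp add: norm_star_mult_self power2_eq_square)
    also have "\<dots> \<le> norm (star y) * norm y"
      by (rule norm_mult_ineq)
    finally show ?thesis
      using False by (simp add: mult_le_cancel_right)
  qed simp
  show ?thesis
    using le[of x] le[of "star x"] by (simp add: star_star)
qed

lemma bounded_linear_star: "bounded_linear (star :: 'a::cstar_algebra \<Rightarrow> 'a)"
  by (rule bounded_linear_intro[where K = 1])
    (auto simp: star_add scaleR_scaleC star_scaleC norm_star)

lemma bounded_linear_scaleC: "bounded_linear (\<lambda>x::'a::complex_normed_vector. c *\<^sub>C x)"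
  by (rule bounded_linear_intro[where K = "cmod c"])
    (auto simp: scaleC_add_right scaleR_scaleC scaleC_scaleC norm_scaleC mult.commute)

lemma bcontfun_compose_bounded_linear:
  "f \<in> bcontfun \<Longrightarrow> bounded_linear g \<Longrightarrow> (\<lambda>x. g (f x)) \<in> bcontfun"
  unfolding bcontfun_def
  by (auto intro: bounded_linear.continuous_on simp: image_image[symmetric] dest: bounded_linear_image)

lemma bcontfun_mult:
  fixes f g :: "'a::topological_space \<Rightarrow> 'b::real_normed_algebra"
  assumes "f \<in> bcontfun" "g \<in> bcontfun"
  shows "(\<lambda>x. f x * g x) \<in> bcontfun"
proof -
  obtain B C where B: "\<And>x. norm (f x) \<le> B" and C: "\<And>x. norm (g x) \<le> C"
    using assms by (auto simp: bcontfun_def bounded_iff)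
  have "norm (f x * g x) \<le> B * C" for x
    using B[of x] C[of x] order_trans[OF norm_ge_zero B]
    by (intro order_trans[OF norm_mult_ineq] mult_mono) auto
  then show ?thesis
    using assms by (intro bcontfun_normI) (auto simp: bcontfun_def intro: continuous_on_mult)
qed

text \<open>The library states completeness for metric domains only; \<^typ>\<open>nat\<close> carries its discrete
  topology but is not an instance of \<^class>\<open>metric_space\<close>.\<close>

instance bcontfun :: (topological_space, complete_space) complete_space
proof
  fix f :: "nat \<Rightarrow> 'a \<Rightarrow>\<^sub>C 'b"
  assume "Cauchy f"
  have "uniformly_Cauchy_on UNIV (\<lambda>n. apply_bcontfun (f n))"
    unfolding uniformly_Cauchy_on_def
    using \<open>Cauchy f\<close> by (meson Cauchy_def dist_bounded le_less_trans)
  then obtain g where "uniform_limit UNIV (\<lambda>n. apply_bcontfun (f n)) g sequentially"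
    using Cauchy_uniformly_convergent uniformly_convergent_on_def by blast
  then obtain l where "f \<longlonglongrightarrow> l"
    using uniform_limit_bcontfunE[of f g sequentially] by auto
  then show "convergent f"
    by (rule convergentI)
qed

instance bcontfun :: (topological_space, banach) banach ..

setup_lifting type_definition_bcontfun

instantiation bcontfun :: (topological_space, cstar_algebra) cstar_algebra
begin

lift_definition scaleC_bcontfun :: "complex \<Rightarrow> ('a \<Rightarrow>\<^sub>C 'b) \<Rightarrow> ('a \<Rightarrow>\<^sub>C 'b)"
  is "\<lambda>c f x. c *\<^sub>C f x"
  by (rule bcontfun_compose_bounded_linear[OF _ bounded_linear_scaleC])

lift_definition star_bcontfun :: "('a \<Rightarrow>\<^sub>C 'b) \<Rightarrow> ('a \<Rightarrow>\<^sub>C 'b)"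
  is "\<lambda>f x. star (f x)"
  by (rule bcontfun_compose_bounded_linear[OF _ bounded_linear_star])

lift_definition times_bcontfun :: "('a \<Rightarrow>\<^sub>C 'b) \<Rightarrow> ('a \<Rightarrow>\<^sub>C 'b) \<Rightarrow> ('a \<Rightarrow>\<^sub>C 'b)"
  is "\<lambda>f g x. f x * g x"
  by (rule bcontfun_mult)

instance
proof
  fix f g h :: "'a \<Rightarrow>\<^sub>C 'b" and c d :: complex and r :: real
  note rep = scaleC_bcontfun.rep_eq star_bcontfun.rep_eq times_bcontfun.rep_eq
  show "c *\<^sub>C (f + g) = c *\<^sub>C f + c *\<^sub>C g"
    by (rule bcontfun_eqI) (simp add: rep scaleC_add_right)
  show "(c + d) *\<^sub>C f = c *\<^sub>C f + d *\<^sub>C f"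
    by (rule bcontfun_eqI) (simp add: rep scaleC_add_left)
  show "c *\<^sub>C d *\<^sub>C f = (c * d) *\<^sub>C f"
    by (rule bcontfun_eqI) (simp add: rep scaleC_scaleC)
  show "r *\<^sub>R f = complex_of_real r *\<^sub>C f"
    by (rule bcontfun_eqI) (simp add: rep scaleR_scaleC)
  show "norm (c *\<^sub>C f) = cmod c * norm f"
  proof (cases "c = 0")
    case True
    have "0 *\<^sub>C y = (0::'b)" for y :: 'b
      using norm_scaleC[of 0 y] by simp
    then have "0 *\<^sub>C f = 0"
      by (intro bcontfun_eqI) (simp add: rep)
    with True show ?thesis by simp
  next
    case False
    have le: "norm (k *\<^sub>C u) \<le> cmod k * norm u" for k and u :: "'a \<Rightarrow>\<^sub>C 'b"
      by (rule norm_bound) (simp add: rep norm_scaleC norm_bounded mult_left_mono)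
    have "inverse c *\<^sub>C (c *\<^sub>C f) = 1 *\<^sub>C f"
      using False by (intro bcontfun_eqI) (simp add: rep scaleC_scaleC)
    also have "\<dots> = f"
    proof (rule bcontfun_eqI)
      fix x
      show "(1 *\<^sub>C f) x = f x"
        using scaleR_scaleC[of 1 "f x"] by (simp add: rep)
    qed
    finally have "norm f \<le> cmod (inverse c) * norm (c *\<^sub>C f)"
      using le[of "inverse c" "c *\<^sub>C f"] by simp
    then have "cmod c * norm f \<le> norm (c *\<^sub>C f)"
      using False by (simp add: norm_inverse norm_divide field_simps)
    with le[of c f] show ?thesis by simp
  qed
  show "f * g * h = f * (g * h)"
    by (rule bcontfun_eqI) (simp add: rep mult.assoc)
  show "(f + g) * h = f * h + g * h"
    by (rule bcontfun_eqI) (simp add: rep distrib_right)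
  show "f * (g + h) = f * g + f * h"
    by (rule bcontfun_eqI) (simp add: rep distrib_left)
  show "r *\<^sub>R f * g = r *\<^sub>R (f * g)" "f * r *\<^sub>R g = r *\<^sub>R (f * g)"
    by (rule bcontfun_eqI; simp add: rep)+
  show "norm (f * g) \<le> norm f * norm g"
    by (rule norm_bound)
      (auto simp: rep intro!: order_trans[OF norm_mult_ineq] mult_mono norm_bounded)
  show "(c *\<^sub>C f) * g = c *\<^sub>C (f * g)" "f * (c *\<^sub>C g) = c *\<^sub>C (f * g)"
    by (rule bcontfun_eqI; simp add: rep mult_scaleC_left mult_scaleC_right)+
  show "star (star f) = f"
    by (rule bcontfun_eqI) (simp add: rep star_star)
  show "star (f + g) = star f + star g"
    by (rule bcontfun_eqI) (simp add: rep star_add)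
  show "star (c *\<^sub>C f) = cnj c *\<^sub>C star f"
    by (rule bcontfun_eqI) (simp add: rep star_scaleC)
  show "star (f * g) = star g * star f"
    by (rule bcontfun_eqI) (simp add: rep star_mult)
  show "norm (star f * f) = (norm f)\<^sup>2"
  proof (rule antisym)
    show "norm (star f * f) \<le> (norm f)\<^sup>2"
      by (rule norm_bound) (simp add: rep norm_star_mult_self power_mono norm_bounded)
    have "norm (f x) \<le> sqrt (norm (star f * f))" for x
      using norm_bounded[of "star f * f" x]
      by (intro real_le_rsqrt) (simp add: rep norm_star_mult_self)
    then have "norm f \<le> sqrt (norm (star f * f))"
      by (rule norm_bound)
    then show "(norm f)\<^sup>2 \<le> norm (star f * f)"
      using power_mono[of "norm f" _ 2] by fastforce
  qed
qed

end

text \<open>As \<^typ>\<open>nat\<close> is discrete, this is the C*-algebra of all bounded complex sequences.\<close>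

type_synonym linfty = "nat \<Rightarrow>\<^sub>C complex"

end

theory Submission
  imports Defs "HOL-Real_Asymp.Real_Asymp"
begin

text \<open>
  If \<open>e\<close> is a unit, then \<open>\<langle>e, x\<^sub>n\<rangle> = x\<^sub>n\<close>, so \<open>\<tau>\<close>-convergence is norm convergence. Conversely, a strictly
  positive \<open>h\<close> with \<open>\<parallel>h\<parallel> \<le> 1\<close> yields the sequential approximate unit \<open>1 - (1 - h)\<^sup>n\<close>; it is
  \<open>\<tau>\<close>-convergent, and its norm limit is a unit. If it were not an approximate unit, a
  Hahn--Banach argument would produce a state vanishing at \<open>h\<close>. In a separable algebra with dense
  sequence \<open>d\<^sub>n\<close>, a convergent sum of positive multiples of \<open>d\<^sub>n\<^sup>* d\<^sub>n\<close> is strictly positive.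

  For the Schur property, every bounded functional \<open>f\<close> is approximated in norm by functionals
  \<open>f(e \<cdot>)\<close>, so that differences of a \<open>\<tau>\<close>-convergent sequence converge weakly to zero.

  Positivity is treated without spectral theory: a self-adjoint \<open>a\<close> is positive iff
  \<open>\<parallel>t - a\<parallel> \<le> t\<close> for some \<open>t \<ge> 0\<close>, square roots come from the iteration \<open>s \<mapsto> (x + s\<^sup>2) / 2\<close>, and norm
  estimates from the unitaries \<open>c \<plusminus> i (1 - c\<^sup>2)\<^sup>1\<^sup>/\<^sup>2\<close>.
\<close>

section \<open>Arithmetic of complex scalars and of the adjoint\<close>

lemma scaleC_zero_left [simp]: "0 *\<^sub>C x = (0::'a::complex_normed_vector)"
  using norm_scaleC[of 0 x] by simp

lemma scaleC_zero_right [simp]: "c *\<^sub>C 0 = (0::'a::complex_normed_vector)"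
  using norm_scaleC[of c 0] by simp

lemma scaleC_one [simp]: "1 *\<^sub>C x = (x::'a::complex_normed_vector)"
  using scaleR_scaleC[of 1 x] by simp

lemma scaleC_minus_left: "(- c) *\<^sub>C x = - (c *\<^sub>C (x::'a::complex_normed_vector))"
  using scaleC_add_left[of c "- c" x] by (simp add: eq_neg_iff_add_eq_0 add.commute)

lemma scaleC_minus_right: "c *\<^sub>C (- x) = - (c *\<^sub>C (x::'a::complex_normed_vector))"
  using scaleC_add_right[of c x "- x"] by (simp add: eq_neg_iff_add_eq_0 add.commute)

lemma scaleC_diff_right: "c *\<^sub>C (x - y) = c *\<^sub>C x - c *\<^sub>C (y::'a::complex_normed_vector)"
  using scaleC_add_right[of c x "- y"] by (simp add: scaleC_minus_right)

lemma star_zero [simp]: "star 0 = (0::'a::cstar_algebra)"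
  using norm_star[of 0] by simp

lemma star_minus: "star (- x) = - star (x::'a::cstar_algebra)"
  using star_add[of x "- x"] by (simp add: eq_neg_iff_add_eq_0 add.commute)

lemma star_diff: "star (x - y) = star x - star (y::'a::cstar_algebra)"
  using star_add[of x "- y"] by (simp add: star_minus)

lemma star_scaleR: "star (r *\<^sub>R x) = r *\<^sub>R star (x::'a::cstar_algebra)"
  by (simp add: scaleR_scaleC star_scaleC)

lemmas star_simps = star_add star_diff star_minus star_scaleR star_scaleC star_mult star_star

lemma star_mult_self_eq_0: "star x * x = 0 \<longleftrightarrow> x = (0::'a::cstar_algebra)"
  using norm_star_mult_self[of x] by auto

lemma norm_mult_star_self: "norm (x * star x) = (norm (x::'a::cstar_algebra))\<^sup>2"
  using norm_star_mult_self[of "star x"] by (simp add: star_star norm_star)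

lemma star_one [simp]: "star 1 = (1::'a::{cstar_algebra,real_normed_algebra_1})"
  by (metis mult.left_neutral mult.right_neutral star_mult star_star)

lemma star_of_real [simp]:
  "star (of_real r) = (of_real r :: 'a::{cstar_algebra,real_normed_algebra_1})"
  by (simp add: of_real_def star_scaleR)

lemma star_power: "star (x ^ n) = star x ^ n" for x :: "'a::{cstar_algebra,real_normed_algebra_1}"
  by (induction n) (simp_all add: star_mult power_commutes)

section \<open>Square roots\<close>

text \<open>Every iterate commutes with whatever commutes with \<open>x\<close> and is self-adjoint
  if \<open>x\<close> is; both properties pass to the limit \<open>s\<close>. The increments are
  dominated by those of the scalar iteration with \<open>x = 1\<close>, so convergence reaches the
  boundary case \<open>norm x = 1\<close>.\<close>

lemma sqrt_one_minus:
  fixes x :: "'a::{cstar_algebra,real_normed_algebra_1}"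
  assumes x: "norm x \<le> 1"
  obtains s where "(1 - s) * (1 - s) = 1 - x" "norm s \<le> 1"
    "\<And>y. y * x = x * y \<Longrightarrow> y * s = s * y" "star x = x \<Longrightarrow> star s = s"
proof -
  define S where "S = rec_nat 0 (\<lambda>_ s. (1/2) *\<^sub>R (x + s * s))"
  \<comment> \<open>The scalar iteration for \<open>x = 1\<close>: it increases, stays below 1, and
    majorizes both the norms and the increments of \<open>S\<close>.\<close>
  define r where "r = rec_nat (0::real) (\<lambda>_ s. (1/2) * (1 + s * s))"
  have S0: "S 0 = 0" and SS: "S (Suc n) = (1/2) *\<^sub>R (x + S n * S n)" for n
    by (simp_all add: S_def)
  have r0: "r 0 = 0" and rS: "r (Suc n) = (1/2) * (1 + r n * r n)" for n
    by (simp_all add: r_def)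
  have r_bd: "0 \<le> r n \<and> r n \<le> 1" for n
    by (induction n) (auto simp: r0 rS mult_le_one)
  have r_inc: "r n \<le> r (Suc n)" for n
  proof -
    have "r (Suc n) - r n = (1 - r n)\<^sup>2 / 2"
      by (simp add: rS power2_eq_square field_simps)
    then show ?thesis by (smt (verit) zero_le_power2 divide_nonneg_pos)
  qed
  have comm: "y * S n = S n * y" if "y * x = x * y" for y n
  proof (induction n)
    case (Suc n)
    have "y * (S n * S n) = S n * S n * y"
      by (metis Suc mult.assoc)
    then show ?case by (simp add: SS distrib_left distrib_right that)
  qed (simp add: S0)
  have commS: "S m * S n = S n * S m" for m n
    using comm[OF comm[OF refl, symmetric], of m n] by simp
  have S_bd: "norm (S n) \<le> r n" for n
  proof (induction n)
    case (Suc n)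
    have "norm (S n * S n) \<le> r n * r n"
      using Suc r_bd by (intro order_trans[OF norm_mult_ineq] mult_mono) auto
    then show ?case using x norm_triangle_ineq[of x "S n * S n"] by (simp add: SS rS)
  qed (simp add: S0 r0)
  have S_diff: "norm (S (Suc n) - S n) \<le> r (Suc n) - r n" for n
  proof (induction n)
    case 0
    show ?case using x by (simp add: S0 r0 SS rS)
  next
    case (Suc n)
    have "(1/2) *\<^sub>R (x + a) - (1/2) *\<^sub>R (x + b) = (1/2) *\<^sub>R (a - b)" for a b
      by (simp add: algebra_simps)
    from this[of "S (Suc n) * S (Suc n)" "S n * S n", folded SS]
    have "S (Suc (Suc n)) - S (Suc n) = (1/2) *\<^sub>R (S (Suc n) * S (Suc n) - S n * S n)" .
    \<comment> \<open>The iterates commute with one another, so the difference of squares factors as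
      for scalars.\<close>
    also have "S (Suc n) * S (Suc n) - S n * S n = (S (Suc n) - S n) * (S (Suc n) + S n)"
      using commS[of n "Suc n"] by (simp add: algebra_simps)
    finally have "norm (S (Suc (Suc n)) - S (Suc n))
        \<le> (1/2) * (norm (S (Suc n) - S n) * norm (S (Suc n) + S n))"
      using norm_mult_ineq by auto
    also have "norm (S (Suc n) - S n) * norm (S (Suc n) + S n)
        \<le> (r (Suc n) - r n) * (r (Suc n) + r n)"
      using Suc norm_triangle_ineq[of "S (Suc n)" "S n"] S_bd[of n] S_bd[of "Suc n"] r_inc[of n]
      by (intro mult_mono) auto
    also have "(1/2) * ((r (Suc n) - r n) * (r (Suc n) + r n)) = r (Suc (Suc n)) - r (Suc n)"
      by (simp add: rS[of "Suc n"] rS[of n] field_simps)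
    finally show ?case by simp
  qed
  have "summable (\<lambda>n. r (Suc n) - r n)"
  proof -
    have "convergent r"
      using r_inc r_bd by (intro Bseq_mono_convergent BseqI'[of _ 1]) (auto intro: lift_Suc_mono_le)
    then show ?thesis by (auto simp: convergent_def intro: sums_summable telescope_sums)
  qed
  then have "summable (\<lambda>n. S (Suc n) - S n)"
    by (rule summable_comparison_test'[of _ 0]) (rule S_diff)
  then have "convergent (\<lambda>n. \<Sum>i<n. S (Suc i) - S i)"
    by (simp add: summable_iff_convergent)
  then obtain s where s: "S \<longlonglongrightarrow> s"
    by (auto simp: sum_lessThan_telescope S0 convergent_def)
  have "(\<lambda>n. S (Suc n)) \<longlonglongrightarrow> (1/2) *\<^sub>R (x + s * s)"
    unfolding SS by (intro tendsto_intros s)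
  then have "s = (1/2) *\<^sub>R (x + s * s)"
    using LIMSEQ_unique LIMSEQ_Suc[OF s] by blast
  then have "s + s = x + s * s"
    by (metis scaleR_half_double scaleR_add_right)
  then have 1: "(1 - s) * (1 - s) = 1 - x" by (simp add: algebra_simps)
  have 2: "norm s \<le> 1"
    using tendsto_norm[OF s] S_bd r_bd by (rule_tac LIMSEQ_le_const2) (auto intro: order_trans)
  have 3: "y * s = s * y" if "y * x = x * y" for y
    using tendsto_mult_left[OF s, of y] tendsto_mult_right[OF s, of y] comm[OF that]
    by (auto intro: LIMSEQ_unique)
  have 4: "star s = s" if "star x = x"
  proof -
    have "star (S n) = S n" for n
      by (induction n) (simp_all add: S0 SS star_simps that)
    then show ?thesis
      using LIMSEQ_unique[OF bounded_linear.tendsto[OF bounded_linear_star s]] s by simp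
  qed
  show thesis using that 1 2 3 4 by blast
qed

section \<open>The positive cone\<close>

text \<open>For self-adjoint \<open>a\<close> the inequality places the spectrum in
  \<open>[0, 2 t]\<close>. Closure under addition becomes a triangle inequality; an algebra that may
  lack a unit is treated through \<open>uembed\<close>.\<close>

definition nonneg :: "'a::{cstar_algebra,real_normed_algebra_1} \<Rightarrow> bool" where
  "nonneg a \<longleftrightarrow> star a = a \<and> (\<exists>t\<ge>0. norm (of_real t - a) \<le> t)"

lemma nonneg_star: "nonneg a \<Longrightarrow> star a = a"
  by (simp add: nonneg_def)

lemma nonneg_add:
  assumes "nonneg a" "nonneg b" shows "nonneg (a + b)"
proof -
  obtain s t where st: "s \<ge> 0" "t \<ge> 0" "norm (of_real s - a) \<le> s" "norm (of_real t - b) \<le> t"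
    using assms by (auto simp: nonneg_def)
  have "norm (of_real (s + t) - (a + b)) \<le> s + t"
    using norm_triangle_ineq[of "of_real s - a" "of_real t - b"] st by (simp add: algebra_simps)
  with st show ?thesis
    using assms unfolding nonneg_def by (metis add_nonneg_nonneg star_add)
qed

lemma nonneg_scaleR:
  assumes "nonneg a" "0 \<le> c" shows "nonneg (c *\<^sub>R a)"
proof -
  obtain s where s: "s \<ge> 0" "norm (of_real s - a) \<le> s"
    using assms by (auto simp: nonneg_def)
  have "norm (of_real (c * s) - c *\<^sub>R a) = norm (c *\<^sub>R (of_real s - a))"
    by (simp add: scaleR_conv_of_real right_diff_distrib)
  also have "\<dots> \<le> c * s" using s assms by (simp add: mult_left_mono)
  finally show ?thesis
    using s assms unfolding nonneg_def by (metis mult_nonneg_nonneg star_scaleR)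
qed

lemma nonneg_norm_diff:
  assumes "star a = a" "norm a \<le> r" shows "nonneg (of_real r - a)"
  unfolding nonneg_def using assms order_trans[OF norm_ge_zero, of a r]
  by (auto simp: star_diff intro!: exI[of _ r])

lemma nonneg_of_real: "0 \<le> r \<Longrightarrow> nonneg (of_real r)"
  using nonneg_norm_diff[of 0 r] by simp

text \<open>Rescaling by a witness \<open>t\<close> turns \<open>a\<close> into \<open>1 - x\<close>
  with \<open>norm x \<le> 1\<close>. The bound \<open>norm s \<le> 1\<close> then says that
  \<open>sqrt t\<close> is a witness for \<open>nonneg k\<close>.\<close>

lemma nonneg_sqrt:
  fixes a :: "'a::{cstar_algebra,real_normed_algebra_1}"
  assumes "nonneg a"
  obtains k where "nonneg k" "k * k = a" "\<And>y. y * a = a * y \<Longrightarrow> y * k = k * y"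
proof -
  obtain t where t: "t \<ge> 0" "norm (of_real t - a) \<le> t" and sa: "star a = a"
    using assms by (auto simp: nonneg_def)
  show thesis
  proof (cases "t = 0")
    case True
    with t have "a = 0" by simp
    then show thesis using that[of 0] nonneg_of_real[of 0] by simp
  next
    case False
    with t have "t > 0" by simp
    define x where "x = (1/t) *\<^sub>R (of_real t - a)"
    have x: "x = 1 - (1/t) *\<^sub>R a"
      using \<open>t > 0\<close> by (simp add: x_def scaleR_diff_right of_real_def)
    have "norm x \<le> 1" using t \<open>t > 0\<close> by (simp add: x_def)
    then obtain s where s: "(1 - s) * (1 - s) = 1 - x" "norm s \<le> 1"
      "\<And>y. y * x = x * y \<Longrightarrow> y * s = s * y" "star x = x \<Longrightarrow> star s = s"
      using sqrt_one_minus[of x] by blast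
    define k where "k = sqrt t *\<^sub>R (1 - s)"
    have "k * k = t *\<^sub>R ((1 - s) * (1 - s))"
      using t by (simp add: k_def)
    then have kk: "k * k = a" using s \<open>t > 0\<close> by (simp add: x)
    have "star s = s" by (rule s(4)) (simp add: x star_simps sa)
    then have "star k = k" by (simp add: k_def star_simps)
    moreover have "of_real (sqrt t) - k = sqrt t *\<^sub>R s"
      by (simp add: k_def scaleR_diff_right of_real_def)
    then have "norm (of_real (sqrt t) - k) \<le> sqrt t"
      using s t mult_left_mono[of "norm s" 1 "sqrt t"] by simp
    ultimately have "nonneg k" using t by (auto simp: nonneg_def intro!: exI[of _ "sqrt t"])
    moreover have "y * k = k * y" if "y * a = a * y" for y
    proof -
      have "y * s = s * y" by (rule s(3)) (simp add: x algebra_simps that)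
      then show ?thesis by (simp add: k_def algebra_simps)
    qed
    ultimately show thesis using that kk by blast
  qed
qed

text \<open>In \<open>star u * u\<close> the cross terms cancel by commutation and leave
  \<open>c * c + e * e = 1\<close>; the C*-identity does the rest.\<close>

lemma norm_unitary_eq_1:
  fixes c e :: "'a::{cstar_algebra,real_normed_algebra_1}"
  assumes "star c = c" "star e = e" "c * e = e * c" "c * c + e * e = 1"
  shows "norm (c + \<i> *\<^sub>C e) = 1" "norm (c - \<i> *\<^sub>C e) = 1"
proof -
  have "norm (star u * u) = 1 \<Longrightarrow> norm u = 1" for u :: 'a
    using norm_star_mult_self[of u] by (simp add: power2_eq_1_iff) (smt (verit) norm_ge_zero)
  moreover have "star (c + \<i> *\<^sub>C e) * (c + \<i> *\<^sub>C e) = c * c + e * e"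
    "star (c - \<i> *\<^sub>C e) * (c - \<i> *\<^sub>C e) = c * c + e * e"
    using assms(3)
    by (simp_all add: star_simps assms(1,2) algebra_simps mult_scaleC_left mult_scaleC_right
      scaleC_scaleC scaleC_minus_left scaleC_add_right scaleC_diff_right)
  ultimately show "norm (c + \<i> *\<^sub>C e) = 1" "norm (c - \<i> *\<^sub>C e) = 1"
    using assms(4) by auto
qed

text \<open>This is the double-angle formula: for the unitary \<open>u = c + \<i> e\<close> the
  element \<open>2 c\<^sup>2 - 1\<close> is the mean of \<open>u\<^sup>2\<close> and
  \<open>(star u)\<^sup>2\<close>, hence a contraction.\<close>

lemma norm_double_square_minus_one:
  fixes c :: "'a::{cstar_algebra,real_normed_algebra_1}"
  assumes c: "star c = c" "norm c \<le> 1"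
  shows "norm (2 *\<^sub>R (c * c) - 1) \<le> 1"
proof -
  have "norm (c * c) \<le> 1"
    using c by (intro order_trans[OF norm_mult_ineq] mult_le_one) auto
  then obtain s where s: "(1 - s) * (1 - s) = 1 - c * c"
      "\<And>y. y * (c * c) = (c * c) * y \<Longrightarrow> y * s = s * y" "star (c * c) = c * c \<Longrightarrow> star s = s"
    by (metis sqrt_one_minus)
  define e where "e = 1 - s"
  have "c * e = e * c" using s(2)[of c] by (simp add: e_def algebra_simps)
  moreover have "star e = e" using s(3) c by (simp add: e_def star_simps)
  moreover have "c * c + e * e = 1" using s(1) by (simp add: e_def)
  ultimately have u: "norm (c + \<i> *\<^sub>C e) = 1" "norm (c - \<i> *\<^sub>C e) = 1"
    and ce: "c * e = e * c" "c * c + e * e = 1"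
    using norm_unitary_eq_1[of c e] c by auto
  have "(c + \<i> *\<^sub>C e) * (c + \<i> *\<^sub>C e) + (c - \<i> *\<^sub>C e) * (c - \<i> *\<^sub>C e)
      = 2 *\<^sub>R (c * c - e * e)"
    using ce(1) by (simp add: algebra_simps mult_scaleC_left mult_scaleC_right
      scaleC_scaleC scaleC_minus_left scaleC_add_right scaleC_diff_right scaleR_2)
  also have "c * c - e * e = 2 *\<^sub>R (c * c) - 1"
    using ce(2) by (simp add: scaleR_2 algebra_simps flip: ce(2))
  finally have "2 * norm (2 *\<^sub>R (c * c) - 1)
      = norm ((c + \<i> *\<^sub>C e) * (c + \<i> *\<^sub>C e) + (c - \<i> *\<^sub>C e) * (c - \<i> *\<^sub>C e))"
    by simp
  also have "\<dots> \<le> 1 * 1 + 1 * 1"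
    by (rule order_trans[OF norm_triangle_ineq])
      (intro add_mono order_trans[OF norm_mult_ineq]; simp add: u)
  finally show ?thesis by simp
qed

text \<open>For \<open>c\<close> scaled to \<open>norm d \<le> 1\<close> the double-angle bound is
  the definition of \<open>nonneg (2 d\<^sup>2)\<close> with witness 1.\<close>

lemma nonneg_square:
  fixes c :: "'a::{cstar_algebra,real_normed_algebra_1}"
  assumes c: "star c = c"
  shows "nonneg (c * c)"
proof (cases "c = 0")
  case True
  then show ?thesis using nonneg_of_real[of 0] by simp
next
  case False
  define d where "d = (1 / norm c) *\<^sub>R c"
  have d: "star d = d" "norm d \<le> 1" using False c by (simp_all add: d_def star_scaleR)
  have "nonneg (2 *\<^sub>R (d * d))"
    using norm_double_square_minus_one[OF d] d
    by (auto simp: nonneg_def star_simps norm_minus_commute intro!: exI[of _ 1])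
  then have "nonneg ((norm c * norm c / 2) *\<^sub>R (2 *\<^sub>R (d * d)))"
    by (rule nonneg_scaleR) simp
  also have "(norm c * norm c / 2) *\<^sub>R (2 *\<^sub>R (d * d)) = c * c"
    using False by (simp add: d_def)
  finally show ?thesis .
qed

text \<open>The root \<open>k\<close> of \<open>a\<close> commutes with \<open>b\<close>, hence with
  the root \<open>l\<close> of \<open>b\<close>. Thus \<open>k * l\<close> is self-adjoint and its
  square is \<open>a * b\<close>.\<close>

lemma nonneg_mult:
  assumes "nonneg a" "nonneg b" "a * b = b * a"
  shows "nonneg (a * b)"
proof -
  obtain k where k: "nonneg k" "k * k = a" "\<And>y. y * a = a * y \<Longrightarrow> y * k = k * y"
    using nonneg_sqrt[OF assms(1)] by blast
  have bk: "b * k = k * b" using k(3) assms(3) by simp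
  obtain l where l: "nonneg l" "l * l = b" "\<And>y. y * b = b * y \<Longrightarrow> y * l = l * y"
    using nonneg_sqrt[OF assms(2)] by blast
  have kl: "k * l = l * k" using l(3) bk by simp
  have "nonneg ((k * l) * (k * l))"
    by (rule nonneg_square) (simp add: star_mult nonneg_star k l kl)
  also have "(k * l) * (k * l) = a * b"
    using kl by (metis k(2) l(2) mult.assoc)
  finally show ?thesis .
qed

lemma nonneg_power: "nonneg a \<Longrightarrow> nonneg (a ^ n)"
  using nonneg_of_real[of 1] by (induction n) (auto intro!: nonneg_mult simp: power_commutes)

text \<open>The product of \<open>a\<close> and \<open>- a\<close> has a positive root
  \<open>e\<close>, so \<open>a\<^sup>2 + e\<^sup>2 = 0\<close>. The left side is
  \<open>star u * u\<close> for \<open>u = a + \<i> e\<close>; hence \<open>u = 0\<close>, and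
  adding the adjoint equation gives \<open>a + a = 0\<close>.\<close>

lemma nonneg_antisym:
  fixes a :: "'a::{cstar_algebra,real_normed_algebra_1}"
  assumes "nonneg a" "nonneg (- a)"
  shows "a = 0"
proof -
  have sa: "star a = a" using assms by (simp add: nonneg_star)
  have "nonneg (a * - a)" using assms by (intro nonneg_mult) auto
  then obtain e where e: "nonneg e" "e * e = a * - a" "\<And>y. y * (a * - a) = (a * - a) * y \<Longrightarrow> y * e = e * y"
    using nonneg_sqrt by blast
  have ae: "a * e = e * a" by (rule e(3)) (simp add: mult.assoc)
  have "star (a + \<i> *\<^sub>C e) * (a + \<i> *\<^sub>C e) = a * a + e * e"
    using ae by (simp add: star_simps sa nonneg_star[OF e(1)] algebra_simps mult_scaleC_left
      mult_scaleC_right scaleC_scaleC scaleC_minus_left scaleC_add_right scaleC_diff_right)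
  also have "\<dots> = 0" using e(2) by simp
  finally have 1: "a + \<i> *\<^sub>C e = 0" by (simp add: star_mult_self_eq_0)
  then have "star (a + \<i> *\<^sub>C e) = 0" by simp
  then have "a - \<i> *\<^sub>C e = 0" by (simp add: star_simps sa nonneg_star[OF e(1)] scaleC_minus_left)
  with 1 have "a + a = 0" by (simp add: eq_neg_iff_add_eq_0)
  then show ?thesis by (metis scaleR_2 scaleR_eq_0_iff zero_neq_numeral)
qed

text \<open>An iterated C*-identity. It lets the norm of a self-adjoint element be read off from the
  growth of its powers, in place of a spectral radius.\<close>

lemma norm_power_two_power:
  fixes a :: "'a::{cstar_algebra,real_normed_algebra_1}"
  assumes "star a = a"
  shows "norm (a ^ (2 ^ k)) = norm a ^ (2 ^ k)"
proof (induction k)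
  case (Suc k)
  have "a ^ (2 ^ Suc k) = star (a ^ (2 ^ k)) * a ^ (2 ^ k)"
    by (simp add: star_power assms mult_2 power_add)
  then show ?case using Suc by (simp add: norm_star_mult_self power_mult[symmetric] mult.commute)
qed simp

lemma le_1_of_power_linear_bound:
  fixes w C :: real
  assumes "0 \<le> w" "\<And>k. w ^ (2 ^ k) \<le> 1 + 2 ^ k * C"
  shows "w \<le> 1"
proof (rule ccontr)
  assume "\<not> w \<le> 1"
  then have "(\<lambda>n. (1 + real n * C) / w ^ n) \<longlonglongrightarrow> 0"
    by real_asymp
  moreover have "filterlim (\<lambda>k. 2 ^ k :: nat) at_top at_top"
    by (intro filterlim_subseq) (simp add: strict_mono_def)
  ultimately have "(\<lambda>k. (1 + real (2 ^ k) * C) / w ^ (2 ^ k)) \<longlonglongrightarrow> 0"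
    by (rule filterlim_compose)
  then have "\<forall>\<^sub>F k in sequentially. (1 + real (2 ^ k) * C) / w ^ (2 ^ k) < 1"
    by (rule order_tendstoD) simp
  then obtain k where "(1 + real (2 ^ k) * C) / w ^ (2 ^ k) < 1"
    by (auto simp: eventually_sequentially)
  then show False
    using assms(2)[of k] \<open>\<not> w \<le> 1\<close> by (simp add: divide_less_eq)
qed

text \<open>This stands in for the equality of the spectra of \<open>star y * y\<close> and
  \<open>y * star y\<close> away from 0. If \<open>v = 1 + star y * y\<close> is a contraction, then
  \<open>y * v = w * y\<close> makes the powers of \<open>w = 1 + y * star y\<close> grow at most
  linearly, which for the self-adjoint \<open>w\<close> forces
  \<open>norm w \<le> 1\<close>.\<close>

lemma nonneg_uminus_mult_star:
  fixes y :: "'a::{cstar_algebra,real_normed_algebra_1}"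
  assumes "nonneg (- (star y * y))"
  shows "nonneg (- (y * star y))"
proof -
  have *: "nonneg (- (y * star y))" if y: "norm (1 + star y * y) \<le> 1" for y :: 'a
  proof -
    define v w where "v = 1 + star y * y" and "w = 1 + y * star y"
    have "star w = w" by (simp add: w_def star_simps)
    have "y * v = w * y" by (simp add: v_def w_def algebra_simps)
    then have wy: "y * v ^ n = w ^ n * y" for n
      by (induction n) (simp_all add: algebra_simps power_commutes, metis mult.assoc power_commutes)
    have "norm (w ^ n) \<le> 1 + real n * (norm y)\<^sup>2" for n
    proof (induction n)
      case (Suc n)
      \<comment> \<open>Pulling \<open>w ^ n\<close> through \<open>y\<close> leaves a power of the
        contraction \<open>v\<close>, so each step adds at most
        \<open>(norm y)\<^sup>2\<close>.\<close>
      have "w ^ Suc n = w ^ n + (w ^ n * y) * star y"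
        by (simp add: power_Suc2 w_def algebra_simps del: power_Suc)
      also have "\<dots> = w ^ n + y * v ^ n * star y" by (simp add: wy)
      finally have "norm (w ^ Suc n) \<le> norm (w ^ n) + norm (y * v ^ n * star y)"
        by (metis norm_triangle_ineq)
      also have "norm (y * v ^ n * star y) \<le> norm y * 1 * norm y"
        using y by (intro order_trans[OF norm_mult_ineq] mult_mono order_trans[OF norm_power_ineq])
          (auto simp: v_def power_le_one norm_star)
      finally show ?case using Suc by (simp add: power2_eq_square algebra_simps)
    qed simp
    then have "norm w ^ (2 ^ k) \<le> 1 + 2 ^ k * (norm y)\<^sup>2" for k
      using norm_power_two_power[OF \<open>star w = w\<close>, of k] by (metis of_nat_numeral of_nat_power)
    then have "norm w \<le> 1" by (intro le_1_of_power_linear_bound) auto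
    then show ?thesis
      by (auto simp: nonneg_def w_def star_simps intro!: exI[of _ 1])
  qed
  obtain t where t: "t \<ge> 0" "norm (of_real t + star y * y) \<le> t"
    using assms by (auto simp: nonneg_def)
  show ?thesis
  proof (cases "t = 0")
    case True
    then have "y = 0" using t by (simp add: star_mult_self_eq_0)
    then show ?thesis using nonneg_of_real[of 0] by simp
  next
    case False
    with t have "t > 0" by simp
    define z where "z = (1 / sqrt t) *\<^sub>R y"
    have "1 + star z * z = (1/t) *\<^sub>R (of_real t + star y * y)"
      using \<open>t > 0\<close> by (simp add: z_def star_scaleR scaleR_add_right of_real_def)
    then have "norm (1 + star z * z) \<le> 1" using t \<open>t > 0\<close> by simp
    from nonneg_scaleR[OF *[OF this] t(1)]
    have "nonneg (t *\<^sub>R - (z * star z))" .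
    also have "t *\<^sub>R - (z * star z) = - (y * star y)"
      using \<open>t > 0\<close> by (simp add: z_def star_scaleR)
    finally show ?thesis .
  qed
qed

text \<open>\<open>p\<close> and \<open>q\<close> are, up to sign, twice the real and imaginary
  parts of \<open>y\<close>, so \<open>star y * y + y * star y\<close> is half a sum of squares and
  positive. Both summands are also negative, so the sum vanishes; then \<open>star y * y\<close>,
  being minus the other summand, has both signs.\<close>

lemma star_mult_self_nonpos_imp_zero:
  fixes y :: "'a::{cstar_algebra,real_normed_algebra_1}"
  assumes "nonneg (- (star y * y))"
  shows "y = 0"
proof -
  define p q where "p = y + star y" and "q = \<i> *\<^sub>C (y - star y)"
  have "star p = p" "star q = q"
    by (simp_all add: p_def q_def star_simps scaleC_minus_left algebra_simps scaleC_diff_right)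
  then have "nonneg (p * p + q * q)"
    by (intro nonneg_add nonneg_square)
  also have "p * p + q * q = 2 *\<^sub>R (star y * y + y * star y)"
    by (simp add: p_def q_def algebra_simps mult_scaleC_left mult_scaleC_right scaleC_scaleC
      scaleC_minus_left scaleC_add_right scaleC_diff_right scaleR_2)
  finally have "nonneg ((1/2) *\<^sub>R (2 *\<^sub>R (star y * y + y * star y)))"
    by (rule nonneg_scaleR) simp
  then have 1: "nonneg (star y * y + y * star y)" by simp
  have 2: "nonneg (- (y * star y))" by (rule nonneg_uminus_mult_star[OF assms])
  have "nonneg (- (star y * y + y * star y))"
    using nonneg_add[OF assms 2] by simp
  with 1 have "star y * y + y * star y = 0" by (rule nonneg_antisym)
  then have "nonneg (star y * y)" using 2 by (simp add: eq_neg_iff_add_eq_0[symmetric])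
  then have "star y * y = 0" using assms by (rule nonneg_antisym)
  then show ?thesis by (simp add: star_mult_self_eq_0)
qed

text \<open>With \<open>a = b\<^sup>* b\<close> and \<open>n = |a| - a\<close>, twice the negative part of \<open>a\<close>, the element
  \<open>(b n)\<^sup>* (b n) = n a n = - |a| n\<^sup>2\<close> is negative, which forces \<open>b n = 0\<close> and hence \<open>n = 0\<close>.\<close>

theorem nonneg_star_mult_self:
  fixes b :: "'a::{cstar_algebra,real_normed_algebra_1}"
  shows "nonneg (star b * b)"
proof -
  define a where "a = star b * b"
  have sa: "star a = a" by (simp add: a_def star_simps)
  obtain m where m: "nonneg m" "m * m = a * a" "\<And>y. y * (a * a) = (a * a) * y \<Longrightarrow> y * m = m * y"
    using nonneg_sqrt[OF nonneg_square[OF sa]] by blast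
  have am: "a * m = m * a" by (rule m(3)) (simp add: mult.assoc)
  \<comment> \<open>The root of \<open>m\<close> exhibits \<open>n * (m * n)\<close> as the square
    of the self-adjoint element \<open>k * n\<close>.\<close>
  obtain k where k: "nonneg k" "k * k = m" "\<And>y. y * m = m * y \<Longrightarrow> y * k = k * y"
    using nonneg_sqrt[OF m(1)] by blast
  define n where "n = m - a"
  have sn: "star n = n" by (simp add: n_def star_diff nonneg_star[OF m(1)] sa)
  have an: "a * n = - (m * n)" using am by (simp add: n_def algebra_simps m(2))
  have nk: "n * k = k * n" by (rule k(3)) (simp add: n_def algebra_simps am)
  have nmn: "n * (m * n) = (k * n) * (k * n)"
    using nk by (metis k(2) mult.assoc)
  have skn: "star (k * n) = k * n" by (simp add: star_mult sn nonneg_star[OF k(1)] nk)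
  have bn: "star (b * n) * (b * n) = - ((k * n) * (k * n))"
  proof -
    have "star (b * n) * (b * n) = n * (a * n)" by (simp add: star_mult sn a_def mult.assoc)
    then show ?thesis by (simp add: an nmn)
  qed
  then have "nonneg (- (star (b * n) * (b * n)))"
    using nonneg_square[OF skn] by simp
  then have "b * n = 0" by (rule star_mult_self_nonpos_imp_zero)
  \<comment> \<open>From \<open>b * n = 0\<close> follow in turn \<open>k * n = 0\<close>,
    \<open>m * n = 0\<close> and \<open>a * n = 0\<close>; the difference of the last two is
    \<open>n * n\<close>.\<close>
  with bn have "star (k * n) * (k * n) = 0" by (simp add: skn)
  then have "k * n = 0" by (simp add: star_mult_self_eq_0)
  then have "m * n = 0" using k(2) by (metis mult.assoc mult_zero_right)
  with an have "star n * n = 0" by (simp add: sn) (simp add: n_def algebra_simps)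
  then have "n = 0" by (simp add: star_mult_self_eq_0)
  then show ?thesis using m(1) by (simp add: n_def a_def)
qed

section \<open>Order and norm\<close>

lemma nonneg_conjugate:
  fixes a :: "'a::{cstar_algebra,real_normed_algebra_1}"
  assumes "nonneg a" shows "nonneg (star v * a * v)"
proof -
  obtain k where "nonneg k" "k * k = a" using nonneg_sqrt[OF assms] by blast
  then have "star v * a * v = star (k * v) * (k * v)"
    by (auto simp: star_mult nonneg_star mult.assoc)
  then show ?thesis by (simp add: nonneg_star_mult_self)
qed

text \<open>For \<open>w = 1 - (2/s) x\<close> the element \<open>1 - w\<^sup>2\<close> is a
  multiple of the positive product \<open>x (s - x)\<close>. With its root \<open>e\<close> the
  unitaries \<open>w + \<i> e\<close> and \<open>w - \<i> e\<close> have mean \<open>w\<close>, so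
  \<open>norm w \<le> 1\<close>. Both estimates follow from \<open>2 x = s (1 - w)\<close> and
  \<open>2 (s - x) = s (1 + w)\<close>.\<close>

lemma norm_le_of_nonneg_diff:
  fixes x :: "'a::{cstar_algebra,real_normed_algebra_1}"
  assumes x: "nonneg x" "nonneg (of_real s - x)" and s: "0 < s"
  shows "norm x \<le> s" and "norm (of_real s - x) \<le> s"
proof -
  define w where "w = 1 - (2/s) *\<^sub>R x"
  have sw: "star w = w" by (simp add: w_def star_simps nonneg_star[OF x(1)])
  have "nonneg (x * (of_real s - x))"
    by (rule nonneg_mult[OF x]) (simp add: algebra_simps of_real_def)
  then have "nonneg ((4 / s\<^sup>2) *\<^sub>R (x * (of_real s - x)))"
    using s by (intro nonneg_scaleR) auto
  also have "(4 / s\<^sup>2) *\<^sub>R (x * (of_real s - x)) = 1 - w * w"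
    using s by (simp add: w_def algebra_simps of_real_def power2_eq_square)
      (simp flip: scaleR_add_left)
  finally obtain e where e: "nonneg e" "e * e = 1 - w * w"
      "\<And>y. y * (1 - w * w) = (1 - w * w) * y \<Longrightarrow> y * e = e * y"
    using nonneg_sqrt by blast
  have we: "w * e = e * w" by (rule e(3)) (simp add: algebra_simps)
  have u: "norm (w + \<i> *\<^sub>C e) = 1" "norm (w - \<i> *\<^sub>C e) = 1"
    using norm_unitary_eq_1[OF sw nonneg_star[OF e(1)] we] e(2) by auto
  have "2 * norm w = norm ((w + \<i> *\<^sub>C e) + (w - \<i> *\<^sub>C e))"
    by (simp flip: scaleR_2)
  also have "\<dots> \<le> 2" using norm_triangle_ineq u by (metis one_add_one)
  finally have w: "norm w \<le> 1" by simp
  have "2 *\<^sub>R x = s *\<^sub>R (1 - w)" using s by (simp add: w_def)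
  then have "2 * norm x = s * norm (1 - w)"
    by (metis abs_of_pos norm_scaleR s zero_less_numeral)
  also have "\<dots> \<le> s * 2" using s w norm_triangle_ineq4[of 1 w] by (intro mult_left_mono) auto
  finally show "norm x \<le> s" by simp
  have "1 + w = 2 *\<^sub>R 1 - (2/s) *\<^sub>R x" by (simp add: w_def scaleR_2)
  then have "2 *\<^sub>R (of_real s - x) = s *\<^sub>R (1 + w)"
    using s by (simp add: of_real_def scaleR_diff_right mult.commute)
  then have "2 * norm (of_real s - x) = s * norm (1 + w)"
    by (metis abs_of_pos norm_scaleR s zero_less_numeral)
  also have "\<dots> \<le> s * 2" using s w norm_triangle_ineq[of 1 w] by (intro mult_left_mono) auto
  finally show "norm (of_real s - x) \<le> s" by simp
qed

lemma norm_mono_nonneg: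
  fixes x y :: "'a::{cstar_algebra,real_normed_algebra_1}"
  assumes "nonneg x" "nonneg (y - x)"
  shows "norm x \<le> norm y"
proof (rule field_le_epsilon)
  \<comment> \<open>The slack \<open>e\<close> keeps the scalar bound strictly positive even when
    \<open>norm y = 0\<close>, as \<open>norm_le_of_nonneg_diff\<close> demands.\<close>
  fix e :: real assume e: "0 < e"
  have "star y = y"
    using nonneg_star[OF assms(1)] nonneg_star[OF assms(2)] by (simp add: star_diff)
  then have "nonneg (of_real (norm y + e) - y)"
    using e by (intro nonneg_norm_diff) auto
  from nonneg_add[OF this assms(2)] have "nonneg (of_real (norm y + e) - x)" by simp
  then show "norm x \<le> norm y + e"
    using assms e by (intro norm_le_of_nonneg_diff(1)) (auto intro: add_nonneg_pos)
qed

text \<open>Positivity survives a limit only if all members share one witness; here any positive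
  bound of the norms becomes such a witness.\<close>

lemma norm_of_real_diff_le:
  fixes a :: "'a::{cstar_algebra,real_normed_algebra_1}"
  assumes "nonneg a" "norm a \<le> t" "0 < t"
  shows "norm (of_real t - a) \<le> t"
  using norm_le_of_nonneg_diff(2)[OF assms(1) nonneg_norm_diff] assms nonneg_star by blast

lemma nonneg_LIMSEQ:
  fixes a :: "nat \<Rightarrow> 'a::{cstar_algebra,real_normed_algebra_1}"
  assumes "\<And>n. nonneg (a n)" "a \<longlonglongrightarrow> l"
  shows "nonneg l"
proof -
  obtain K where K: "0 < K" "\<And>n. norm (a n) \<le> K"
    using convergent_imp_Bseq[OF convergentI[OF assms(2)]] by (auto elim: BseqE)
  have "(\<lambda>n. norm (of_real K - a n)) \<longlonglongrightarrow> norm (of_real K - l)"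
    by (intro tendsto_intros assms)
  then have "norm (of_real K - l) \<le> K"
    using norm_of_real_diff_le[OF assms(1) K(2,1)] by (intro LIMSEQ_le_const2) auto
  moreover have "star l = l"
    using LIMSEQ_unique[OF bounded_linear.tendsto[OF bounded_linear_star assms(2)]] assms
    by (simp add: nonneg_star)
  ultimately show ?thesis using K by (auto simp: nonneg_def intro!: exI[of _ K])
qed

text \<open>For \<open>x = 1 - h\<close> the terms \<open>h * x ^ k\<close> decrease in
  \<open>k\<close>. So \<open>n + 1\<close> copies of the last one are dominated by the sum over
  \<open>k \<le> n\<close>, which telescopes to \<open>1 - x ^ Suc n\<close>, an element of norm at
  most 1.\<close>

lemma norm_mult_one_minus_power_le:
  fixes h :: "'a::{cstar_algebra,real_normed_algebra_1}"
  assumes h: "nonneg h" "norm h \<le> 1"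
  shows "norm (h * (1 - h) ^ n) \<le> 1 / (real n + 1)"
proof -
  define x where "x = 1 - h"
  have sx: "star x = x" by (simp add: x_def star_diff nonneg_star h)
  have x: "nonneg x" unfolding x_def
    using nonneg_norm_diff[of h 1] h by (simp add: nonneg_star)
  have nx: "norm x \<le> 1" using norm_of_real_diff_le[of h 1] h by (simp add: x_def)
  then have nxk: "norm (x ^ k) \<le> 1" for k
    by (meson norm_power_ineq order_trans norm_ge_zero power_le_one)
  have hx: "h * x ^ k = x ^ k * h" for k
  proof -
    have "h * x = x * h" by (simp add: x_def algebra_simps)
    then show ?thesis by (metis power_commuting_commutes)
  qed
  have one: "nonneg (1 - x ^ k)" for k
    using nonneg_norm_diff[of "x ^ k" 1] nxk by (simp add: star_power sx)
  have hk: "nonneg (h * x ^ k)" for k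
    by (rule nonneg_mult[OF h(1) nonneg_power[OF x] hx])
  have dec: "nonneg (h * x ^ k - h * x ^ n)" if "k \<le> n" for k
  proof -
    have "(h * x ^ k) * x ^ m = x ^ m * (h * x ^ k)" for m
      using hx[of m] by (metis mult.assoc power_add add.commute)
    then have "nonneg ((h * x ^ k) * (1 - x ^ (n - k)))"
      by (intro nonneg_mult hk one) (simp add: left_diff_distrib right_diff_distrib)
    also have "(h * x ^ k) * (1 - x ^ (n - k)) = h * x ^ k - h * x ^ n"
      using that by (simp add: right_diff_distrib mult.assoc flip: power_add)
    finally show ?thesis .
  qed
  have sum: "(\<Sum>k\<le>m. h * x ^ k) = 1 - x ^ Suc m" for m
    by (induction m) (simp_all add: x_def algebra_simps)
  have "nonneg (\<Sum>k\<le>m. h * x ^ k - h * x ^ n)" if "m \<le> n" for m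
    using that
  proof (induction m)
    case 0
    show ?case using dec[of 0] by simp
  next
    case (Suc m)
    then show ?case using nonneg_add[OF _ dec[of "Suc m"]] by (simp del: power_Suc)
  qed
  from this[of n] have "nonneg ((1 - x ^ Suc n) - (real n + 1) *\<^sub>R (h * x ^ n))"
    unfolding sum_subtractf sum sum_constant_scaleR card_atMost of_nat_Suc by (simp only: add.commute)
  from norm_mono_nonneg[OF _ this] have "norm ((real n + 1) *\<^sub>R (h * x ^ n)) \<le> norm (1 - x ^ Suc n)"
    by (simp add: nonneg_scaleR hk)
  also have "\<dots> \<le> 1"
    using norm_of_real_diff_le[OF nonneg_power[OF x], of "Suc n" 1] nxk[of "Suc n"]
    by (simp del: power_Suc)
  finally have "norm (h * x ^ n) * (real n + 1) \<le> 1" by (simp add: mult.commute)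
  then show ?thesis by (simp add: x_def le_divide_eq)
qed

section \<open>The unitization\<close>

text \<open>The lower bound comes from evaluating at \<open>star a\<close>, where the C*-identity
  gives \<open>(norm a)\<^sup>2\<close>.\<close>

lemma onorm_mult_left: "onorm (\<lambda>y. a * y) = norm (a::'a::cstar_algebra)"
proof (rule antisym)
  show "onorm (\<lambda>y. a * y) \<le> norm a"
    by (rule onorm_bound) (simp_all add: norm_mult_ineq)
  show "norm a \<le> onorm (\<lambda>y. a * y)"
  proof (cases "a = 0")
    case False
    have "norm (a * star a) \<le> onorm (\<lambda>y. a * y) * norm (star a)"
      by (rule onorm) (rule bounded_linear_mult_right)
    then show ?thesis using False by (simp add: norm_mult_star_self norm_star power2_eq_square)
  qed (simp add: onorm_pos_le bounded_linear_mult_right)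
qed

text \<open>The norm includes the scalar part because left multiplication alone is not faithful on
  the unitization when the algebra already has a unit.\<close>

datatype 'a unitization = Unitization (uvec: 'a) (uscal: complex)

definition uop :: "'a::cstar_algebra unitization \<Rightarrow> 'a \<Rightarrow> 'a" where
  "uop u y = uvec u * y + uscal u *\<^sub>C y"

lemma bounded_linear_uop: "bounded_linear (uop u)"
  unfolding uop_def
  by (intro bounded_linear_add bounded_linear_mult_right bounded_linear_scaleC)

instantiation unitization :: (cstar_algebra) complex_normed_vector
begin

definition "(0 :: 'a unitization) = Unitization 0 0"
definition "u + v = Unitization (uvec u + uvec v) (uscal u + uscal v)" for u v :: "'a unitization"
definition "- u = Unitization (- uvec u) (- uscal u)" for u :: "'a unitization"
definition "u - v = Unitization (uvec u - uvec v) (uscal u - uscal v)" for u v :: "'a unitization"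
definition "r *\<^sub>R u = Unitization (r *\<^sub>R uvec u) (r *\<^sub>R uscal u)" for u :: "'a unitization"
definition "c *\<^sub>C u = Unitization (c *\<^sub>C uvec u) (c * uscal u)" for u :: "'a unitization"
definition "norm u = max (onorm (uop u)) (cmod (uscal u))" for u :: "'a unitization"
definition "sgn u = inverse (norm u) *\<^sub>R u" for u :: "'a unitization"
definition "dist u v = norm (u - v)" for u v :: "'a unitization"

definition [code del]:
  "(uniformity :: ('a unitization \<times> 'a unitization) filter) = (INF e\<in>{0<..}. principal {(x, y). dist x y < e})"
definition [code del]:
  "open (U :: 'a unitization set) \<longleftrightarrow> (\<forall>x\<in>U. \<forall>\<^sub>F (x', y) in uniformity. x' = x \<longrightarrow> y \<in> U)"

lemmas uni_defs = zero_unitization_def plus_unitization_def uminus_unitization_def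
  minus_unitization_def scaleR_unitization_def scaleC_unitization_def

lemma uop_simps:
  fixes u v :: "'a unitization"
  shows "uop (u + v) = (\<lambda>y. uop u y + uop v y)"
    and "uop (c *\<^sub>C u) = (\<lambda>y. c *\<^sub>C uop u y)"
  by (auto simp: uop_def uni_defs fun_eq_iff algebra_simps scaleC_add_left scaleC_add_right
      mult_scaleC_left mult_scaleC_right scaleC_scaleC scaleR_scaleC[where 'a='a]
      scaleR_conv_of_real)

lemma norm_uop_le: "norm (uop u y) \<le> norm u * norm (y::'a)"
proof -
  have "norm (uop u y) \<le> onorm (uop u) * norm y"
    by (rule onorm) (rule bounded_linear_uop)
  also have "\<dots> \<le> norm u * norm y"
    by (intro mult_right_mono) (auto simp: norm_unitization_def)
  finally show ?thesis .
qed

lemma norm_unitization_le: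
  fixes u :: "'a unitization"
  assumes "0 \<le> K" "\<And>y. norm (uop u y) \<le> K * norm y" "cmod (uscal u) \<le> K"
  shows "norm u \<le> K"
  using assms by (auto simp: norm_unitization_def intro: onorm_bound)

lemma cmod_uscal_le: "cmod (uscal u) \<le> norm (u :: 'a unitization)"
  by (simp add: norm_unitization_def)

lemma norm_unitization_nonneg: "0 \<le> norm (u :: 'a unitization)"
  by (rule order_trans[OF norm_ge_zero cmod_uscal_le])

lemma norm_triangle_unitization: "norm (u + v) \<le> norm u + norm (v :: 'a unitization)"
proof (rule norm_unitization_le)
  show "norm (uop (u + v) y) \<le> (norm u + norm v) * norm y" for y
    using norm_uop_le[of u y] norm_uop_le[of v y] norm_triangle_ineq[of "uop u y" "uop v y"]
    by (simp add: uop_simps algebra_simps)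
  show "cmod (uscal (u + v)) \<le> norm u + norm v"
    using cmod_uscal_le[of u] cmod_uscal_le[of v] norm_triangle_ineq[of "uscal u" "uscal v"]
    by (simp add: uni_defs)
qed (simp add: norm_unitization_nonneg)

lemma norm_scaleC_unitization: "norm (c *\<^sub>C u) = cmod c * norm (u :: 'a unitization)"
proof -
  have "onorm (\<lambda>y. c *\<^sub>C uop u y) = cmod c * onorm (uop u)"
  proof (cases "c = 0")
    case True
    then show ?thesis by (simp add: onorm_zero)
  next
    case False
    have le: "onorm (\<lambda>y. d *\<^sub>C f y) \<le> cmod d * onorm f" if f: "bounded_linear f"
      for d and f :: "'a \<Rightarrow> 'a"
      using onorm[OF f]
      by (intro onorm_bound) (auto simp: norm_scaleC mult.assoc mult_left_mono onorm_pos_le[OF f])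
    have "onorm (\<lambda>y. inverse c *\<^sub>C (c *\<^sub>C uop u y)) \<le> cmod (inverse c) * onorm (\<lambda>y. c *\<^sub>C uop u y)"
      by (intro le bounded_linear_compose[OF bounded_linear_scaleC bounded_linear_uop])
    then have "cmod c * onorm (uop u) \<le> onorm (\<lambda>y. c *\<^sub>C uop u y)"
      using False by (simp add: scaleC_scaleC norm_divide norm_inverse divide_simps mult.commute)
    with le[OF bounded_linear_uop, of c u] show ?thesis by simp
  qed
  then show ?thesis
    by (simp add: norm_unitization_def uop_simps)
      (simp add: uni_defs norm_mult max_mult_distrib_left)
qed

text \<open>Left multiplication by the vector part is \<open>uop u\<close> less a scalar. With
  \<open>cmod_uscal_le\<close> and \<open>norm_unitization_le_sum\<close> this makes the norm
  equivalent to the sum of the coordinate norms, the source of definiteness and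
  completeness.\<close>

lemma uvec_le: "norm (uvec u) \<le> 2 * norm (u :: 'a unitization)"
proof -
  have "onorm (\<lambda>y. uvec u * y) \<le> 2 * norm u"
  proof (rule onorm_bound)
    fix y
    have "norm (uvec u * y) = norm (uop u y - uscal u *\<^sub>C y)" by (simp add: uop_def)
    also have "\<dots> \<le> norm (uop u y) + norm (uscal u *\<^sub>C y)" by (rule norm_triangle_ineq4)
    also have "\<dots> \<le> norm u * norm y + norm u * norm y"
      by (intro add_mono norm_uop_le) (simp add: norm_scaleC mult_right_mono cmod_uscal_le)
    finally show "norm (uvec u * y) \<le> 2 * norm u * norm y" by (simp add: mult_ac)
  qed (simp add: norm_unitization_nonneg)
  then show ?thesis by (simp add: onorm_mult_left)
qed

lemma norm_unitization_le_sum: "norm (u :: 'a unitization) \<le> norm (uvec u) + cmod (uscal u)"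
proof (rule norm_unitization_le)
  fix y
  show "norm (uop u y) \<le> (norm (uvec u) + cmod (uscal u)) * norm y"
    unfolding uop_def using norm_triangle_ineq[of "uvec u * y" "uscal u *\<^sub>C y"]
      norm_mult_ineq[of "uvec u" y] by (simp add: norm_scaleC distrib_right)
qed auto

instance
proof
  fix u v w :: "'a unitization" and a b :: real and c d :: complex
  show "u + v + w = u + (v + w)" "u + v = v + u" "0 + u = u" "- u + u = 0" "u - v = u + - v"
    by (simp_all add: uni_defs)
  show "a *\<^sub>R (u + v) = a *\<^sub>R u + a *\<^sub>R v" "(a + b) *\<^sub>R u = a *\<^sub>R u + b *\<^sub>R u"
    "a *\<^sub>R b *\<^sub>R u = (a * b) *\<^sub>R u" "1 *\<^sub>R u = u"
    by (simp_all add: uni_defs algebra_simps)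
  show "c *\<^sub>C (u + v) = c *\<^sub>C u + c *\<^sub>C v" "(c + d) *\<^sub>C u = c *\<^sub>C u + d *\<^sub>C u"
    "c *\<^sub>C d *\<^sub>C u = (c * d) *\<^sub>C u" "a *\<^sub>R u = complex_of_real a *\<^sub>C u"
    by (simp_all add: uni_defs scaleC_add_left scaleC_add_right scaleC_scaleC
        scaleR_scaleC[where 'a='a] algebra_simps scaleR_conv_of_real)
  show "dist u v = norm (u - v)" "sgn u = inverse (norm u) *\<^sub>R u"
    by (rule dist_unitization_def, rule sgn_unitization_def)
  show "(uniformity :: ('a unitization \<times> 'a unitization) filter) = (INF e\<in>{0<..}. principal {(x, y). dist x y < e})"
    by (rule uniformity_unitization_def)
  show "open U \<longleftrightarrow> (\<forall>x\<in>U. \<forall>\<^sub>F (x', y) in uniformity. x' = x \<longrightarrow> y \<in> U)" for U :: "'a unitization set"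
    by (rule open_unitization_def)
  show "norm u = 0 \<longleftrightarrow> u = 0"
  proof
    assume "norm u = 0"
    then show "u = 0" using uvec_le[of u] cmod_uscal_le[of u]
      by (cases u) (simp add: uni_defs)
  next
    assume "u = 0"
    then show "norm u = 0"
      using norm_unitization_le_sum[of u] norm_unitization_nonneg[of u] by (simp add: uni_defs)
  qed
  show "norm (u + v) \<le> norm u + norm v" by (rule norm_triangle_unitization)
  show "norm (c *\<^sub>C u) = cmod c * norm u" by (rule norm_scaleC_unitization)
  show "norm (a *\<^sub>R u) = \<bar>a\<bar> * norm u"
    using norm_scaleC_unitization[of "complex_of_real a" u]
    by (simp add: uni_defs scaleR_scaleC[where 'a='a] scaleR_conv_of_real)
qed

end

instantiation unitization :: (cstar_algebra) cstar_algebra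
begin

definition "u * v = Unitization (uvec u * uvec v + uscal u *\<^sub>C uvec v + uscal v *\<^sub>C uvec u)
  (uscal u * uscal v)" for u v :: "'a unitization"
definition "star u = Unitization (star (uvec u)) (cnj (uscal u))" for u :: "'a unitization"

lemmas uni_alg_defs = uni_defs times_unitization_def star_unitization_def

lemma uop_mult: "uop (u * v) = uop u \<circ> uop (v :: 'a unitization)"
  by (auto simp: uop_def uni_alg_defs fun_eq_iff algebra_simps scaleC_add_left scaleC_add_right
      mult_scaleC_left mult_scaleC_right scaleC_scaleC)

text \<open>Taking norms bounds \<open>(norm (uop u y))\<^sup>2\<close> by
  \<open>norm (star u * u) * (norm y)\<^sup>2\<close>, the main half of the C*-identity of the
  unitization.\<close>

lemma star_uop: "star (uop u y) * uop u y = star y * uop (star u * u) (y :: 'a)"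
  by (simp add: uop_def uni_alg_defs star_simps algebra_simps scaleC_add_left scaleC_add_right
      mult_scaleC_left mult_scaleC_right scaleC_scaleC)

lemma norm_mult_unitization: "norm (u * v) \<le> norm u * norm (v :: 'a unitization)"
proof (rule norm_unitization_le)
  show "norm (uop (u * v) y) \<le> (norm u * norm v) * norm y" for y
  proof -
    have "norm (uop u (uop v y)) \<le> norm u * norm (uop v y)" by (rule norm_uop_le)
    also have "\<dots> \<le> norm u * (norm v * norm y)"
      by (intro mult_left_mono norm_uop_le norm_unitization_nonneg)
    finally show ?thesis by (simp add: uop_mult mult.assoc)
  qed
  show "cmod (uscal (u * v)) \<le> norm u * norm v"
    using mult_mono[OF cmod_uscal_le[of u] cmod_uscal_le[of v]]
    by (simp add: uni_alg_defs norm_mult norm_unitization_nonneg)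
qed (simp add: norm_unitization_nonneg)

instance
proof
  fix u v w :: "'a unitization" and a b :: real and c d :: complex
  show "u * v * w = u * (v * w)" "(u + v) * w = u * w + v * w" "u * (v + w) = u * v + u * w"
    "a *\<^sub>R u * v = a *\<^sub>R (u * v)" "u * a *\<^sub>R v = a *\<^sub>R (u * v)"
    "(c *\<^sub>C u) * v = c *\<^sub>C (u * v)" "u * (c *\<^sub>C v) = c *\<^sub>C (u * v)"
    by (simp_all add: uni_alg_defs scaleC_add_left scaleC_add_right scaleC_scaleC
        scaleR_scaleC[where 'a='a] mult_scaleC_left mult_scaleC_right algebra_simps
        scaleR_conv_of_real)
  show "norm (u * v) \<le> norm u * norm v" by (rule norm_mult_unitization)
  show "star (star u) = u" "star (u + v) = star u + star v" "star (c *\<^sub>C u) = cnj c *\<^sub>C star u"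
    "star (u * v) = star v * star u"
    by (simp_all add: uni_alg_defs star_simps algebra_simps)
  show "norm (star u * u) = (norm u)\<^sup>2"
  proof (rule antisym)
    have le: "norm u \<le> sqrt (norm (star u * u))" for u :: "'a unitization"
    proof (rule norm_unitization_le)
      fix y :: 'a
      have "(norm (uop u y))\<^sup>2 = norm (star y * uop (star u * u) y)"
        by (simp flip: star_uop add: norm_star_mult_self)
      also have "\<dots> \<le> norm y * (norm (star u * u) * norm y)"
        by (intro order_trans[OF norm_mult_ineq] mult_mono norm_uop_le) (auto simp: norm_star)
      also have "\<dots> = (sqrt (norm (star u * u)) * norm y)\<^sup>2"
        by (simp add: power2_eq_square norm_unitization_nonneg)
      finally show "norm (uop u y) \<le> sqrt (norm (star u * u)) * norm y"
        by (rule power2_le_imp_le) (simp add: norm_unitization_nonneg)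
      have "(cmod (uscal u))\<^sup>2 = cmod (uscal (star u * u))"
        by (simp add: uni_alg_defs norm_mult power2_eq_square)
      also have "\<dots> \<le> norm (star u * u)" by (rule cmod_uscal_le)
      finally show "cmod (uscal u) \<le> sqrt (norm (star u * u))" by (rule real_le_rsqrt)
    qed (simp add: norm_unitization_nonneg)
    have sq: "norm u * norm u \<le> norm (star u * u)" for u :: "'a unitization"
      using power_mono[OF le[of u] norm_unitization_nonneg, of 2]
      by (simp add: norm_unitization_nonneg power2_eq_square)
    then show "(norm u)\<^sup>2 \<le> norm (star u * u)" by (simp add: power2_eq_square)
    \<comment> \<open>\<open>norm_star\<close> is not yet available for the type being instantiated,
      so its argument is repeated on the basis of \<open>sq\<close>.\<close>
    have le_star: "norm v \<le> norm (star v)" for v :: "'a unitization"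
    proof (cases "norm v = 0")
      case False
      then show ?thesis using order_trans[OF sq[of v] norm_mult_unitization]
          norm_unitization_nonneg[of v] by (simp add: mult_le_cancel_right)
    qed (simp add: norm_unitization_nonneg)
    have "star (star u) = u" by (simp add: uni_alg_defs star_simps)
    then have "norm (star u) \<le> norm u" using le_star[of "star u"] by simp
    then show "norm (star u * u) \<le> (norm u)\<^sup>2"
      unfolding power2_eq_square
      by (intro order_trans[OF norm_mult_unitization] mult_right_mono norm_unitization_nonneg)
  qed
  fix X :: "nat \<Rightarrow> 'a unitization" assume X: "Cauchy X"
  have "Cauchy (\<lambda>n. uvec (X n))" "Cauchy (\<lambda>n. uscal (X n))"
  proof -
    have v: "dist (uvec u) (uvec v) \<le> 2 * dist u v" and s: "dist (uscal u) (uscal v) \<le> dist u v"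
      for u v :: "'a unitization"
      using uvec_le[of "u - v"] cmod_uscal_le[of "u - v"]
      by (simp_all add: dist_norm) (simp_all add: uni_defs)
    show "Cauchy (\<lambda>n. uscal (X n))"
      using X s unfolding Cauchy_def by (meson le_less_trans)
    show "Cauchy (\<lambda>n. uvec (X n))"
      unfolding Cauchy_def
    proof (intro allI impI)
      fix e :: real assume "e > 0"
      then obtain N where "\<forall>m\<ge>N. \<forall>n\<ge>N. dist (X m) (X n) < e / 2"
        using X unfolding Cauchy_def by (meson half_gt_zero)
      then show "\<exists>M. \<forall>m\<ge>M. \<forall>n\<ge>M. dist (uvec (X m)) (uvec (X n)) < e"
        using v by (smt (verit) field_sum_of_halves)
    qed
  qed
  then obtain a s where as: "(\<lambda>n. uvec (X n)) \<longlonglongrightarrow> a" "(\<lambda>n. uscal (X n)) \<longlonglongrightarrow> s"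
    by (auto simp: Cauchy_convergent_iff convergent_def)
  have "(\<lambda>n. norm (uvec (X n) - a) + cmod (uscal (X n) - s)) \<longlonglongrightarrow> norm (a - a) + cmod (s - s)"
    by (intro tendsto_intros as)
  then have lim: "(\<lambda>n. norm (uvec (X n) - a) + cmod (uscal (X n) - s)) \<longlonglongrightarrow> 0" by simp
  have bd: "dist (X n) (Unitization a s) \<le> norm (uvec (X n) - a) + cmod (uscal (X n) - s)" for n
    using norm_unitization_le_sum[of "X n - Unitization a s"]
    by (simp add: dist_norm) (simp add: uni_defs)
  have "X \<longlonglongrightarrow> Unitization a s"
    by (rule metric_tendsto_imp_tendsto[OF lim]) (simp add: bd)
  then show "convergent X" by (rule convergentI)
qed

end

instantiation unitization :: (cstar_algebra) real_normed_algebra_1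
begin

definition "(1 :: 'a unitization) = Unitization 0 1"

instance
proof
  fix u :: "'a unitization"
  show "1 * u = u" "u * 1 = u" "(0 :: 'a unitization) \<noteq> 1"
    by (simp_all add: one_unitization_def uni_alg_defs)
  have "onorm (uop (1 :: 'a unitization)) \<le> 1"
    by (rule onorm_bound) (auto simp: uop_def one_unitization_def)
  then show "norm (1 :: 'a unitization) = 1"
    by (simp add: norm_unitization_def) (simp add: one_unitization_def)
qed

end

definition uembed :: "'a::cstar_algebra \<Rightarrow> 'a unitization" where
  "uembed a = Unitization a 0"

lemma uembed_simps:
  "uembed (a + b) = uembed a + uembed b" "uembed (a - b) = uembed a - uembed b"
  "uembed (- a) = - uembed a" "uembed (a * b) = uembed a * uembed b" "uembed 0 = 0"
  "uembed (r *\<^sub>R a) = r *\<^sub>R uembed a" "uembed (c *\<^sub>C a) = c *\<^sub>C uembed a"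
  "uembed (star a) = star (uembed a)"
  by (simp_all add: uembed_def uni_alg_defs)

lemma uembed_inject: "uembed a = uembed b \<longleftrightarrow> a = b"
  by (simp add: uembed_def)

lemma norm_uembed: "norm (uembed a) = norm a"
proof -
  have "uop (uembed a) = (\<lambda>y. a * y)" by (simp add: uop_def uembed_def fun_eq_iff)
  then show ?thesis by (simp add: norm_unitization_def onorm_mult_left) (simp add: uembed_def)
qed

lemma bounded_linear_uembed: "bounded_linear uembed"
  by (rule bounded_linear_intro[where K = 1]) (simp_all add: uembed_simps norm_uembed)

lemma nonneg_uembed_star_mult: "nonneg (uembed (star b * b))"
  by (simp add: uembed_simps nonneg_star_mult_self)

text \<open>The root is taken in the unitization; its scalar part squares to 0, so it comes from the
  algebra itself.\<close>

lemma nonneg_uembed_imp_positive_element: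
  assumes "nonneg (uembed a)"
  shows "positive_element a"
proof -
  obtain k where k: "nonneg k" "k * k = uembed a"
    using nonneg_sqrt[OF assms] by blast
  then have "uscal k * uscal k = uscal (uembed a)" by (simp flip: k(2)) (simp add: uni_alg_defs)
  then have "k = uembed (uvec k)" by (cases k) (simp add: uembed_def)
  then have "uembed (star (uvec k) * uvec k) = uembed a"
    using k nonneg_star[OF k(1)] by (simp add: uembed_simps)
  then show ?thesis by (auto simp: uembed_inject positive_element_def)
qed

section \<open>The Hahn--Banach theorem\<close>

text \<open>Homogeneity is asked as an inequality; applying it to the inverse factor recovers
  equality in \<open>sublinear_scaleR\<close>.\<close>

definition sublinear :: "('v::real_vector \<Rightarrow> real) \<Rightarrow> bool" where
  "sublinear p \<longleftrightarrow> p 0 = 0 \<and> (\<forall>x y. p (x + y) \<le> p x + p y) \<and> (\<forall>c>0. \<forall>x. p (c *\<^sub>R x) \<le> c * p x)"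

lemma sublinear_scaleR:
  assumes p: "sublinear p" and c: "0 \<le> c"
  shows "p (c *\<^sub>R x) = c * p x"
proof (cases "c = 0")
  case True
  then show ?thesis using p by (simp add: sublinear_def)
next
  case False
  with c have c: "c > 0" by simp
  then have "p ((1/c) *\<^sub>R (c *\<^sub>R x)) \<le> (1/c) * p (c *\<^sub>R x)"
    using p unfolding sublinear_def by (meson zero_less_divide_1_iff)
  then have "c * p x \<le> p (c *\<^sub>R x)" using c by (simp add: field_simps)
  then show ?thesis using p c by (simp add: sublinear_def antisym)
qed

lemma sublinear_minus: "sublinear p \<Longrightarrow> - p (- x) \<le> p x"
  unfolding sublinear_def by (metis add.right_inverse le_minus_iff minus_le_iff
      add_increasing2 le_add_same_cancel1 diff_ge_0_iff_ge diff_minus_eq_add)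

lemma le_cINF_add:
  fixes F :: "'i \<Rightarrow> real" and G :: "'j \<Rightarrow> real"
  assumes "I \<noteq> {}" "J \<noteq> {}" "\<And>i j. i \<in> I \<Longrightarrow> j \<in> J \<Longrightarrow> m \<le> F i + G j"
  shows "m \<le> (INF i\<in>I. F i) + (INF j\<in>J. G j)"
proof -
  have "m - F i \<le> (INF j\<in>J. G j)" if "i \<in> I" for i
    by (rule cINF_greatest[OF assms(2)]) (use assms(3)[OF that] in \<open>simp add: diff_le_eq add.commute\<close>)
  then have "m - (INF j\<in>J. G j) \<le> (INF i\<in>I. F i)"
    by (intro cINF_greatest[OF assms(1)]) (simp add: algebra_simps)
  then show ?thesis by simp
qed

text \<open>The result lies below \<open>q\<close> and is at most \<open>- q a\<close> at
  \<open>- a\<close> (take \<open>t = 1\<close>), so a linear functional below it must take the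
  value \<open>q a\<close> at \<open>a\<close>.\<close>

definition sublinear_shift :: "('v::real_vector \<Rightarrow> real) \<Rightarrow> 'v \<Rightarrow> 'v \<Rightarrow> real" where
  "sublinear_shift q a x = (INF t\<in>{0..}. q (x + t *\<^sub>R a) - t * q a)"

lemma sublinear_shift_bdd:
  assumes q: "sublinear q"
  shows "bdd_below ((\<lambda>t. q (x + t *\<^sub>R a) - t * q a) ` {0..})"
proof (rule bdd_belowI2)
  fix t :: real assume t: "t \<in> {0..}"
  have "t * q a = q ((x + t *\<^sub>R a) + - x)" using sublinear_scaleR[OF q, of t a] t by simp
  also have "\<dots> \<le> q (x + t *\<^sub>R a) + q (- x)" using q by (simp only: sublinear_def)
  finally show "- q (- x) \<le> q (x + t *\<^sub>R a) - t * q a" by simp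
qed

lemma sublinear_shift_le:
  assumes "sublinear q" "0 \<le> t"
  shows "sublinear_shift q a x \<le> q (x + t *\<^sub>R a) - t * q a"
  unfolding sublinear_shift_def
  by (rule cINF_lower[OF sublinear_shift_bdd[OF assms(1)]]) (simp add: assms(2))

lemma sublinear_shift:
  assumes q: "sublinear q"
  shows "sublinear (sublinear_shift q a)"
  unfolding sublinear_def
proof (intro conjI allI impI)
  show "sublinear_shift q a 0 = 0"
    by (simp add: sublinear_shift_def sublinear_scaleR[OF q])
  show "sublinear_shift q a (x + y) \<le> sublinear_shift q a x + sublinear_shift q a y" for x y
  proof -
    have "sublinear_shift q a (x + y)
        \<le> (q (x + s *\<^sub>R a) - s * q a) + (q (y + t *\<^sub>R a) - t * q a)" if "0 \<le> s" "0 \<le> t" for s t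
    proof -
      have "q ((x + s *\<^sub>R a) + (y + t *\<^sub>R a)) \<le> q (x + s *\<^sub>R a) + q (y + t *\<^sub>R a)"
        using q by (simp only: sublinear_def)
      then show ?thesis using sublinear_shift_le[OF q, of "s + t" a "x + y"] that
        by (simp add: algebra_simps)
    qed
    then show ?thesis unfolding sublinear_shift_def[of q a x] sublinear_shift_def[of q a y]
      by (intro le_cINF_add) auto
  qed
  fix c :: real and x assume c: "0 < c"
  have "sublinear_shift q a (c *\<^sub>R x) / c \<le> q (x + t *\<^sub>R a) - t * q a" if "0 \<le> t" for t
  proof -
    have "q (c *\<^sub>R x + (c * t) *\<^sub>R a) = c * q (x + t *\<^sub>R a)"
      using c by (simp flip: sublinear_scaleR[OF q] add: scaleR_add_right)
    then have "sublinear_shift q a (c *\<^sub>R x) \<le> c * (q (x + t *\<^sub>R a) - t * q a)"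
      using sublinear_shift_le[OF q, of "c * t" a "c *\<^sub>R x"] that c by (simp add: algebra_simps)
    then show ?thesis using c by (simp add: divide_le_eq mult.commute)
  qed
  then have "sublinear_shift q a (c *\<^sub>R x) / c \<le> sublinear_shift q a x"
    unfolding sublinear_shift_def[of q a x] by (intro cINF_greatest) auto
  then show "sublinear_shift q a (c *\<^sub>R x) \<le> c * sublinear_shift q a x"
    using c by (simp add: divide_le_eq mult.commute)
qed

text \<open>A minimal sublinear functional \<open>m\<close> is linear, because it agrees with the smaller
  functional \<^term>\<open>sublinear_shift m a\<close>.\<close>

theorem hahn_banach:
  fixes p :: "'v::real_vector \<Rightarrow> real"
  assumes p: "sublinear p"
  obtains f where "linear f" "\<And>x. f x \<le> p x" "f a = p a"
proof -
  \<comment> \<open>Minimizing below \<open>p0\<close> rather than \<open>p\<close> is what fixes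
    the value at \<open>a\<close>.\<close>
  define p0 where "p0 = sublinear_shift p a"
  have p0: "sublinear p0" unfolding p0_def by (rule sublinear_shift[OF p])
  define Q where "Q = {q. sublinear q \<and> q \<le> p0}"
  have "\<exists>m\<in>Q. \<forall>q\<in>Q. q \<le> m \<longrightarrow> q = m"
  proof (rule predicate_Zorn)
    show "partial_order_on Q (relation_of (\<lambda>x y. y \<le> x) Q)"
      by (rule partial_order_on_relation_ofI) auto
    fix C assume "C \<in> Chains (relation_of (\<lambda>x y. y \<le> x) Q)"
    then have C: "C \<subseteq> Q" "\<And>q r. q \<in> C \<Longrightarrow> r \<in> C \<Longrightarrow> q \<le> r \<or> r \<le> q"
      by (auto simp: Chains_def relation_of_def)
    show "\<exists>u\<in>Q. \<forall>q\<in>C. u \<le> q"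
    proof (cases "C = {}")
      case True
      then show ?thesis using p0 by (auto simp: Q_def)
    next
      case False
      \<comment> \<open>The pointwise infimum bounds the chain from below. It is subadditive
        because, of any two members of the chain, the smaller one lies below both.\<close>
      define u where "u x = (INF q\<in>C. q x)" for x
      have sub: "sublinear q" if "q \<in> C" for q using C that by (auto simp: Q_def)
      have bdd: "bdd_below ((\<lambda>q. q x) ` C)" for x
      proof (rule bdd_belowI2)
        fix q assume q: "q \<in> C"
        then have "q (- x) \<le> p0 (- x)" using C by (auto simp: Q_def le_fun_def)
        then show "- p0 (- x) \<le> q x" using sublinear_minus[OF sub[OF q], of x] by simp
      qed
      have u_le: "u x \<le> q x" if "q \<in> C" for q x
        unfolding u_def by (rule cINF_lower[OF bdd that])
      have "sublinear u"
        unfolding sublinear_def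
      proof (intro conjI allI impI)
        have "(\<lambda>q. q 0) ` C = (\<lambda>q. 0) ` C"
          using sub by (intro image_cong) (auto simp: sublinear_def)
        then show "u 0 = 0" using False by (simp add: u_def)
        show "u (x + y) \<le> u x + u y" for x y
        proof -
          have "u (x + y) \<le> q x + r y" if qr: "q \<in> C" "r \<in> C" for q r
          proof -
            obtain s where s: "s \<in> C" "s \<le> q" "s \<le> r" using C(2)[OF qr] qr by blast
            have "u (x + y) \<le> s (x + y)" by (rule u_le[OF s(1)])
            also have "\<dots> \<le> s x + s y" using sub[OF s(1)] by (simp add: sublinear_def)
            also have "\<dots> \<le> q x + r y" using s by (simp add: add_mono le_funD)
            finally show ?thesis .
          qed
          then show ?thesis unfolding u_def[of x] u_def[of y] using False by (intro le_cINF_add)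
        qed
        fix c :: real and x assume c: "0 < c"
        have "u (c *\<^sub>R x) / c \<le> q x" if "q \<in> C" for q
          using u_le[OF that, of "c *\<^sub>R x"] sublinear_scaleR[OF sub[OF that], of c x] c
          by (simp add: divide_le_eq mult.commute)
        then have "u (c *\<^sub>R x) / c \<le> u x"
          unfolding u_def[of x] using False by (intro cINF_greatest) auto
        then show "u (c *\<^sub>R x) \<le> c * u x" using c by (simp add: divide_le_eq mult.commute)
      qed
      moreover have "u \<le> p0"
      proof -
        obtain q where "q \<in> C" using False by blast
        then show ?thesis using u_le C unfolding Q_def le_fun_def by (blast intro: order_trans)
      qed
      ultimately show ?thesis using u_le by (auto simp: Q_def le_fun_def)
    qed
  qed
  then obtain m where m: "sublinear m" "m \<le> p0" "\<And>q. sublinear q \<Longrightarrow> q \<le> m \<Longrightarrow> q = m"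
    unfolding Q_def by (auto intro: order_trans)
  have add: "m (x + y) = m x + m y" for x y
  proof -
    have "sublinear_shift m y = m"
      using m(3) sublinear_shift[OF m(1)] sublinear_shift_le[OF m(1), of 0] by (simp add: le_fun_def)
    then have "m x \<le> m (x + y) - m y" using sublinear_shift_le[OF m(1), of 1 y x] by simp
    then show ?thesis using m(1) by (simp add: sublinear_def antisym)
  qed
  have m0: "m 0 = 0" using m(1) by (simp add: sublinear_def)
  have neg: "m (- x) = - m x" for x
    using add[of x "- x"] m0 by simp
  have "m (c *\<^sub>R x) = c * m x" for c x
    using sublinear_scaleR[OF m(1), of c x] sublinear_scaleR[OF m(1), of "- c" x] neg[of "c *\<^sub>R x"]
    by (cases "0 \<le> c") auto
  then have "linear m" by (intro linearI) (simp_all add: add)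
  moreover have p0_le: "p0 x \<le> p x" for x
    unfolding p0_def using sublinear_shift_le[OF p, of 0 a x] by simp
  then have "m x \<le> p x" for x using m(2) by (meson le_funD order_trans)
  moreover have "m a = p a"
  proof (rule antisym)
    have "m (- a) \<le> p0 (- a)" using m(2) by (simp add: le_fun_def)
    also have "\<dots> \<le> p (- a + 1 *\<^sub>R a) - 1 * p a"
      unfolding p0_def by (rule sublinear_shift_le[OF p]) simp
    also have "\<dots> = - p a" using p by (simp add: sublinear_def)
    finally show "p a \<le> m a" by (simp add: neg)
  qed (simp add: calculation)
  ultimately show thesis using that by blast
qed

section \<open>Approximate units\<close>

text \<open>The recursion expands \<open>1 - (1 - h) ^ n\<close> inside the algebra, where there
  need be no \<open>1\<close>.\<close>

primrec approx_unit :: "'a::cstar_algebra \<Rightarrow> nat \<Rightarrow> 'a" where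
  "approx_unit h 0 = 0"
| "approx_unit h (Suc n) = approx_unit h n + h - approx_unit h n * h"

lemma uembed_approx_unit: "uembed (approx_unit h n) = 1 - (1 - uembed h) ^ n"
proof (induction n)
  case (Suc n)
  show ?case
    by (simp add: Suc uembed_simps power_Suc2 del: power_Suc) (simp add: algebra_simps)
qed (simp add: uembed_simps)

lemma uembed_minus_approx_unit: "uembed (z - approx_unit h n * z) = (1 - uembed h) ^ n * uembed z"
  by (simp add: uembed_simps uembed_approx_unit algebra_simps)

lemma one_minus_uembed_power:
  assumes "nonneg (uembed h)" "norm h \<le> 1"
  shows "norm ((1 - uembed h) ^ n) \<le> 1" "star ((1 - uembed h) ^ n) = (1 - uembed h) ^ n"
proof -
  have "norm (1 - uembed h) \<le> 1"
    using norm_of_real_diff_le[OF assms(1), of 1] assms by (simp add: norm_uembed)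
  then show "norm ((1 - uembed h) ^ n) \<le> 1"
    by (meson norm_power_ineq order_trans norm_ge_zero power_le_one)
  show "star ((1 - uembed h) ^ n) = (1 - uembed h) ^ n"
    by (simp add: star_power star_diff nonneg_star assms)
qed

lemma norm_minus_approx_unit_le:
  assumes "nonneg (uembed h)" "norm h \<le> 1"
  shows "norm (y - approx_unit h n * y) \<le> norm y"
proof -
  have "norm (y - approx_unit h n * y) = norm ((1 - uembed h) ^ n * uembed y)"
    by (metis norm_uembed uembed_minus_approx_unit)
  also have "\<dots> \<le> 1 * norm y"
    using one_minus_uembed_power(1)[OF assms]
    by (intro order_trans[OF norm_mult_ineq] mult_mono) (auto simp: norm_uembed)
  finally show ?thesis by simp
qed

text \<open>For \<open>v = (1 - h) ^ n\<close> in the unitization the left side is the norm of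
  \<open>v (z * star z) v\<close>. Conjugating the domination by \<open>v\<close> bounds it by
  \<open>e (v v)\<close> and \<open>t v (h v)\<close>, where \<open>h v\<close> has norm at most
  \<open>1 / (n + 1)\<close>.\<close>

lemma norm_minus_approx_unit_bound:
  fixes z :: "'a::cstar_algebra"
  assumes h: "nonneg (uembed h)" "norm h \<le> 1"
    and e: "0 \<le> e" and t: "0 \<le> t"
    and le: "nonneg (of_real e + t *\<^sub>R uembed h - uembed (z * star z))"
  shows "(norm (z - approx_unit h n * z))\<^sup>2 \<le> e + t / (real n + 1)"
proof -
  define v where "v = (1 - uembed h) ^ n"
  have v: "norm v \<le> 1" "star v = v" using one_minus_uembed_power[OF h] by (simp_all add: v_def)
  have eq: "uembed (z - approx_unit h n * z) = v * uembed z"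
    by (simp add: uembed_minus_approx_unit v_def)
  have "norm (z - approx_unit h n * z) = norm (v * uembed z)"
    by (metis eq norm_uembed)
  then have "(norm (z - approx_unit h n * z))\<^sup>2 = norm ((v * uembed z) * star (v * uembed z))"
    by (simp only: norm_mult_star_self)
  also have "(v * uembed z) * star (v * uembed z) = v * uembed (z * star z) * v"
    by (simp add: star_mult v uembed_simps mult.assoc)
  also have "norm \<dots> \<le> norm (v * (of_real e + t *\<^sub>R uembed h) * v)"
  proof (rule norm_mono_nonneg)
    show "nonneg (v * uembed (z * star z) * v)"
      using nonneg_conjugate[OF nonneg_uembed_star_mult[of "star z"], of v] by (simp add: v star_star)
    show "nonneg (v * (of_real e + t *\<^sub>R uembed h) * v - v * uembed (z * star z) * v)"
      using nonneg_conjugate[OF le, of v] by (simp add: v left_diff_distrib right_diff_distrib)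
  qed
  also have "v * (of_real e + t *\<^sub>R uembed h) * v = e *\<^sub>R (v * v) + t *\<^sub>R (v * (uembed h * v))"
    by (simp add: algebra_simps of_real_def)
  also have "norm \<dots> \<le> e * (1 * 1) + t * (1 * (1 / (real n + 1)))"
  proof (rule order_trans[OF norm_triangle_ineq], rule add_mono)
    have "norm (v * v) \<le> 1 * 1"
      using v by (intro order_trans[OF norm_mult_ineq] mult_mono) auto
    then show "norm (e *\<^sub>R (v * v)) \<le> e * (1 * 1)"
      using e by (simp add: mult_left_le)
    have "norm (uembed h * v) \<le> 1 / (real n + 1)"
      unfolding v_def by (rule norm_mult_one_minus_power_le) (use h in \<open>auto simp: norm_uembed\<close>)
    then have "norm (v * (uembed h * v)) \<le> 1 * (1 / (real n + 1))"
      using v(1) by (intro order_trans[OF norm_mult_ineq[of v]] mult_mono) auto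
    then show "norm (t *\<^sub>R (v * (uembed h * v))) \<le> t * (1 * (1 / (real n + 1)))"
      using t by (simp only: norm_scaleR abs_of_nonneg mult_left_mono)
  qed
  finally show ?thesis by simp
qed

text \<open>\<open>z * star z\<close> dominates itself, so the previous bound applies with
  \<open>e = 0\<close> and \<open>t = 1\<close>. Every single element thus has its own left
  approximate unit, without a strictly positive element.\<close>

lemma norm_minus_approx_unit_self:
  fixes z :: "'a::cstar_algebra"
  assumes "norm z \<le> 1"
  shows "(norm (z - approx_unit (z * star z) n * z))\<^sup>2 \<le> 1 / (real n + 1)"
proof -
  have "nonneg (uembed (z * star z))"
    using nonneg_uembed_star_mult[of "star z"] by (simp add: star_star)
  moreover have "norm (z * star z) \<le> 1"
    using assms by (simp add: norm_mult_star_self power_le_one)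
  ultimately show ?thesis
    using norm_minus_approx_unit_bound[of "z * star z" 0 1 z n] nonneg_of_real[of 0] by simp
qed

text \<open>This makes the products norm dense, so that a bounded functional vanishing on products
  is zero.\<close>

lemma left_factor_approx:
  fixes z :: "'a::cstar_algebra"
  obtains e where "(\<lambda>n. e n * z) \<longlonglongrightarrow> z"
proof -
  define w where "w = (1 / (norm z + 1)) *\<^sub>R z"
  have "norm z / (norm z + 1) \<le> 1" by (simp add: divide_le_eq_1) (smt (verit) norm_ge_zero)
  then have "norm w \<le> 1" by (simp add: w_def)
  then have "norm (w - approx_unit (w * star w) n * w) \<le> sqrt (1 / (real n + 1))" for n
    using norm_minus_approx_unit_self[of w n] by (intro real_le_rsqrt)
  moreover have "(\<lambda>n. sqrt (1 / (real n + 1))) \<longlonglongrightarrow> 0" by real_asymp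
  ultimately have "(\<lambda>n. w - approx_unit (w * star w) n * w) \<longlonglongrightarrow> 0"
    by (rule_tac Lim_null_comparison) auto
  from tendsto_diff[OF tendsto_const[of w] this]
  have "(\<lambda>n. approx_unit (w * star w) n * w) \<longlonglongrightarrow> w" by simp
  from tendsto_scaleR[OF tendsto_const[of "norm z + 1"] this]
  have "(\<lambda>n. approx_unit (w * star w) n * z) \<longlonglongrightarrow> z"
    using norm_ge_zero[of z] by (simp add: w_def add_nonneg_eq_0_iff)
  then show thesis by (rule that)
qed

section \<open>Strictly positive elements\<close>

lemma bounded_clinear_functional_scaleR:
  assumes "bounded_clinear_functional \<phi>"
  shows "bounded_clinear_functional (\<lambda>x. r *\<^sub>R \<phi> x)"
  using assms
  by (auto simp: bounded_clinear_functional_def intro: bounded_linear_compose[OF bounded_linear_scaleR_right])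

text \<open>If \<open>a\<close> is not dominated by \<open>\<epsilon> + t h\<close> for any \<open>t\<close>, then
  \<open>x \<mapsto> inf {l \<ge> 0. \<exists>t \<ge> 0. Re x \<le> l + t h}\<close> is a sublinear functional that is positive at \<open>a\<close>;
  a linear functional below it is positive and vanishes at \<open>h\<close>.\<close>

lemma strictly_positive_dominates:
  fixes h a :: "'a::cstar_algebra"
  assumes h: "strictly_positive h" and a: "star a = a" and e: "0 < e"
  obtains t where "0 \<le> t" "nonneg (of_real e + t *\<^sub>R uembed h - uembed a)"
proof (rule ccontr)
  assume "\<not> thesis"
  with that have no: "\<not> nonneg (of_real e + t *\<^sub>R uembed h - uembed a)" if "0 \<le> t" for t
    using \<open>0 \<le> t\<close> by blast
  have nh: "nonneg (uembed h)"
    using h by (auto simp: strictly_positive_def positive_element_def nonneg_uembed_star_mult)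
  then have sh: "star h = h"
    by (metis nonneg_star uembed_inject uembed_simps(8))
  \<comment> \<open>Domination concerns self-adjoint elements; passing to real parts extends
    \<open>p\<close> to the whole algebra.\<close>
  define re :: "'a \<Rightarrow> 'a" where "re x = (1/2) *\<^sub>R (x + star x)" for x
  have re_add: "re (x + y) = re x + re y" for x y
    by (simp add: re_def star_add algebra_simps)
  have re_scaleR: "re (c *\<^sub>R x) = c *\<^sub>R re x" for c x
    by (simp add: re_def star_scaleR algebra_simps)
  have re_sa: "re x = x" if "star x = x" for x
    using that by (simp add: re_def flip: scaleR_2)
  have star_re: "star (re x) = re x" for x
    by (simp add: re_def star_simps add.commute)
  have norm_re: "norm (re x) \<le> norm x" for x
    using norm_triangle_ineq[of x "star x"] by (simp add: re_def norm_star)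
  define S where "S x = {l. 0 \<le> l \<and> (\<exists>t\<ge>0. nonneg (of_real l + t *\<^sub>R uembed h - uembed (re x)))}" for x
  define p where "p x = Inf (S x)" for x
  have SI: "l \<in> S x" if "0 \<le> l" "0 \<le> t" "nonneg (of_real l + t *\<^sub>R uembed h - uembed (re x))" for l t x
    using that by (auto simp: S_def)
  \<comment> \<open>The choice \<open>t = 0\<close> shows that \<open>S x\<close> is nonempty and
    later bounds \<open>f\<close> by the norm.\<close>
  have S_norm: "norm (re x) \<in> S x" for x
    by (rule SI[of _ 0])
      (auto intro: nonneg_norm_diff simp: norm_uembed star_re simp flip: uembed_simps(8))
  have bdd: "bdd_below (S x)" for x
    by (rule bdd_belowI[of _ 0]) (simp add: S_def)
  have p_le: "p x \<le> l" if "l \<in> S x" for x l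
    unfolding p_def by (rule cInf_lower[OF that bdd])
  have p_ge: "m \<le> p x" if "\<And>l. l \<in> S x \<Longrightarrow> m \<le> l" for x m
    unfolding p_def by (rule cInf_greatest) (use S_norm that in auto)
  have p_nonneg: "0 \<le> p x" for x
    by (rule p_ge) (simp add: S_def)
  have S_add: "k + l \<in> S (x + y)" if kl: "k \<in> S x" "l \<in> S y" for k l x y
  proof -
    obtain s t where st: "0 \<le> s" "0 \<le> t" "nonneg (of_real k + s *\<^sub>R uembed h - uembed (re x))"
        "nonneg (of_real l + t *\<^sub>R uembed h - uembed (re y))"
      using kl by (auto simp: S_def)
    have "nonneg (of_real (k + l) + (s + t) *\<^sub>R uembed h - uembed (re (x + y)))"
      using nonneg_add[OF st(3,4)] by (simp add: re_add uembed_simps algebra_simps)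
    then show ?thesis using kl st by (intro SI[of _ "s + t"]) (auto simp: S_def)
  qed
  have S_scaleR: "c * l \<in> S (c *\<^sub>R x)" if c: "0 < c" and l: "l \<in> S x" for c l x
  proof -
    obtain t where t: "0 \<le> t" "nonneg (of_real l + t *\<^sub>R uembed h - uembed (re x))"
      using l by (auto simp: S_def)
    have "nonneg (of_real (c * l) + (c * t) *\<^sub>R uembed h - uembed (re (c *\<^sub>R x)))"
      using nonneg_scaleR[OF t(2), of c] c
      by (simp add: re_scaleR uembed_simps algebra_simps scaleR_conv_of_real)
    then show ?thesis using l t c by (intro SI[of _ "c * t"]) (auto simp: S_def)
  qed
  have zero_in_S: "0 \<in> S x" if "nonneg (t *\<^sub>R uembed h - uembed (re x))" "0 \<le> t" for x t
    using that by (intro SI[of _ t]) auto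
  have re0: "re 0 = 0" by (simp add: re_def)
  have "sublinear p"
    unfolding sublinear_def
  proof (intro conjI allI impI)
    have "0 \<in> S 0" using zero_in_S[of 0 0] nonneg_of_real[of 0] by (simp add: re0 uembed_simps)
    then show "p 0 = 0" using p_le p_nonneg by (meson antisym)
    show "p (x + y) \<le> p x + p y" for x y
    proof -
      have "p (x + y) - l \<le> p x" if "l \<in> S y" for l
        by (rule p_ge) (use p_le[OF S_add[OF _ that]] in \<open>simp add: diff_le_eq\<close>)
      then have "p (x + y) - p x \<le> p y"
        by (intro p_ge) (simp add: algebra_simps)
      then show ?thesis by simp
    qed
    fix c :: real and x assume c: "0 < c"
    have "p (c *\<^sub>R x) / c \<le> p x"
      by (rule p_ge) (use p_le[OF S_scaleR[OF c]] c in \<open>simp add: divide_le_eq mult.commute\<close>)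
    then show "p (c *\<^sub>R x) \<le> c * p x" using c by (simp add: divide_le_eq mult.commute)
  qed
  then obtain f where f: "linear f" "\<And>x. f x \<le> p x" "f a = p a"
    using hahn_banach by metis
  \<comment> \<open>A smaller \<open>l\<close> in \<open>S a\<close> could be raised to
    \<open>e\<close> by adding the positive scalar \<open>e - l\<close>, against
    \<open>no\<close>.\<close>
  have "e \<le> p a"
  proof (rule p_ge, rule ccontr)
    fix l assume l: "l \<in> S a" "\<not> e \<le> l"
    then obtain t where t: "0 \<le> t" "nonneg (of_real l + t *\<^sub>R uembed h - uembed a)"
      by (auto simp: S_def re_sa a)
    have "nonneg (of_real (e - l) + (of_real l + t *\<^sub>R uembed h - uembed a))"
      using l by (intro nonneg_add t nonneg_of_real) auto
    also have "of_real (e - l) + (of_real l + t *\<^sub>R uembed h - uembed a)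
        = of_real e + t *\<^sub>R uembed h - uembed a" by simp
    finally show False using no t by blast
  qed
  then have fa: "0 < f a" using e f by simp
  have f_neg: "f (- x) = - f x" for x by (rule linear_neg[OF f(1)])
  have f_le0: "f x \<le> 0" if "nonneg (t *\<^sub>R uembed h - uembed (re x))" "0 \<le> t" for x t
    using p_le[OF zero_in_S[OF that]] f(2)[of x] by simp
  have f_bound: "\<bar>f x\<bar> \<le> norm x" for x
  proof -
    have "f y \<le> norm y" for y
      using f(2)[of y] p_le[OF S_norm[of y]] norm_re[of y] by simp
    from this[of x] this[of "- x"] show ?thesis by (simp add: f_neg)
  qed
  have f_pos: "0 \<le> f (star b * b)" for b
  proof -
    have "re (- (star b * b)) = - (star b * b)" by (rule re_sa) (simp add: star_simps)
    then have "f (- (star b * b)) \<le> 0"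
      by (intro f_le0[of 0]) (simp_all only: scaleR_zero_left uembed_simps(3) diff_minus_eq_add
          add_0 nonneg_uembed_star_mult order_refl)
    then show ?thesis by (simp add: f_neg)
  qed
  have fh: "f h = 0"
  proof (rule antisym)
    show "f h \<le> 0"
      by (rule f_le0[of 1]) (simp_all add: re_sa[OF sh] nonneg_of_real[of 0, simplified])
    have "re (- h) = - h" by (rule re_sa) (simp add: star_minus sh)
    then have "f (- h) \<le> 0" by (intro f_le0[of 0]) (simp_all add: uembed_simps nh)
    then show "0 \<le> f h" by (simp add: f_neg)
  qed
  \<comment> \<open>The real part of \<open>\<i> x\<close> is 0, so \<open>f\<close> is at most 0
    there, for \<open>x\<close> as well as for \<open>- x\<close>.\<close>
  have f_skew: "f (\<i> *\<^sub>C x) = 0" if x: "star x = x" for x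
  proof -
    have le: "f (\<i> *\<^sub>C y) \<le> 0" if "star y = y" for y
    proof (rule f_le0[of 0])
      have "re (\<i> *\<^sub>C y) = 0" by (simp add: re_def star_scaleC that scaleC_minus_left)
      then show "nonneg (0 *\<^sub>R uembed h - uembed (re (\<i> *\<^sub>C y)))"
        using nonneg_of_real[of 0] by (simp add: uembed_simps)
    qed simp
    from le[OF x] le[of "- x"] show ?thesis by (simp add: star_minus x scaleC_minus_right f_neg)
  qed
  \<comment> \<open>The complex-linear functional with real part \<open>f\<close>; by
    \<open>f_skew\<close> it agrees with \<open>f\<close> on self-adjoint elements.\<close>
  define \<phi> where "\<phi> x = complex_of_real (f x) - \<i> * complex_of_real (f (\<i> *\<^sub>C x))" for x
  have f_add: "f (x + y) = f x + f y" and f_scaleR: "f (r *\<^sub>R x) = r * f x" for x y r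
    using f(1) by (simp_all add: linear_add linear_scale)
  have \<phi>_clinear: "\<phi> (c *\<^sub>C x) = c * \<phi> x" for c x
  proof -
    have c: "c *\<^sub>C y = Re c *\<^sub>R y + Im c *\<^sub>R (\<i> *\<^sub>C y)" for y :: 'a
      unfolding scaleR_scaleC scaleC_scaleC scaleC_add_left[symmetric]
      by (rule arg_cong[of _ _ "\<lambda>d. d *\<^sub>C y"]) (simp add: complex_eq_iff)
    have i: "\<i> *\<^sub>C (c *\<^sub>C x) = Re c *\<^sub>R (\<i> *\<^sub>C x) - Im c *\<^sub>R x"
      by (simp add: c[of x] scaleC_add_right scaleR_scaleC scaleC_scaleC scaleC_minus_left mult.commute)
    have "f (Re c *\<^sub>R (\<i> *\<^sub>C x) - Im c *\<^sub>R x) = Re c * f (\<i> *\<^sub>C x) - Im c * f x"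
      using f_add[of "Re c *\<^sub>R (\<i> *\<^sub>C x)" "- (Im c *\<^sub>R x)"] by (simp add: f_neg f_scaleR)
    then show ?thesis
      unfolding \<phi>_def i by (simp add: c[of x] f_add f_scaleR complex_eq_iff)
  qed
  have \<phi>_lin: "bounded_linear \<phi>"
  proof (rule bounded_linear_intro[where K = 2])
    show "\<phi> (x + y) = \<phi> x + \<phi> y" for x y
      by (simp add: \<phi>_def f_add scaleC_add_right algebra_simps)
    show "\<phi> (r *\<^sub>R x) = r *\<^sub>R \<phi> x" for r x
      by (simp add: scaleR_scaleC \<phi>_clinear scaleR_conv_of_real scaleC_complex_def)
    show "norm (\<phi> x) \<le> norm x * 2" for x
      using norm_triangle_ineq4[of "complex_of_real (f x)" "\<i> * complex_of_real (f (\<i> *\<^sub>C x))"]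
        f_bound[of x] f_bound[of "\<i> *\<^sub>C x"] by (simp add: \<phi>_def norm_mult norm_scaleC)
  qed
  have \<phi>_sa: "\<phi> x = complex_of_real (f x)" if "star x = x" for x
    using f_skew[OF that] by (simp add: \<phi>_def)
  define N where "N = onorm \<phi>"
  have "N \<noteq> 0"
  proof
    assume "N = 0"
    then have "norm (\<phi> a) \<le> 0" using onorm[OF \<phi>_lin, of a] by (simp add: N_def)
    then show False using fa by (simp add: \<phi>_sa[OF a])
  qed
  then have N: "N > 0" using onorm_pos_le[OF \<phi>_lin] by (simp add: N_def)
  have "state (\<lambda>x. (1/N) *\<^sub>R \<phi> x)"
    unfolding state_def
  proof (intro conjI allI impI)
    show "bounded_clinear_functional (\<lambda>x. (1/N) *\<^sub>R \<phi> x)"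
      by (rule bounded_clinear_functional_scaleR)
        (simp add: bounded_clinear_functional_def \<phi>_lin \<phi>_clinear)
    show "onorm (\<lambda>x. (1/N) *\<^sub>R \<phi> x) = 1"
      using N onorm_scaleR[OF \<phi>_lin, of "1/N"] by (simp add: N_def)
    fix b :: 'a assume "positive_element b"
    then obtain c where b: "b = star c * c" by (auto simp: positive_element_def)
    then have "\<phi> b = complex_of_real (f b)" by (intro \<phi>_sa) (simp add: star_simps)
    then show "(1/N) *\<^sub>R \<phi> b \<in> \<real>\<^sub>\<ge>\<^sub>0"
      using f_pos[of c] N by (simp add: b complex_nonneg_Reals_iff)
  qed
  then have "0 < Re ((1/N) *\<^sub>R \<phi> h)" using h by (auto simp: strictly_positive_def)
  then show False by (simp add: \<phi>_sa[OF sh] fh)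
qed

text \<open>Domination of \<open>z * star z\<close> by \<open>r/2 + t h\<close> makes the squared
  error at most \<open>r/2\<close> plus a term of order \<open>1 / n\<close>. Only \<open>t\<close>
  depends on \<open>z\<close>, so the one sequence built from the rescaled \<open>h\<close> serves
  all \<open>z\<close>.\<close>

lemma strictly_positive_approx_unit:
  fixes h :: "'a::cstar_algebra"
  assumes "strictly_positive h"
  obtains e :: "nat \<Rightarrow> 'a" where "\<And>z. (\<lambda>n. e n * z) \<longlonglongrightarrow> z"
proof -
  define k where "k = (1 / (norm h + 1)) *\<^sub>R h"
  have hk: "h = (norm h + 1) *\<^sub>R k"
    using norm_ge_zero[of h] by (simp add: k_def add_nonneg_eq_0_iff)
  have "nonneg (uembed h)"
    using assms by (auto simp: strictly_positive_def positive_element_def nonneg_uembed_star_mult)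
  then have k: "nonneg (uembed k)" by (simp add: k_def uembed_simps nonneg_scaleR)
  have "norm h / (norm h + 1) \<le> 1" by (simp add: divide_le_eq_1) (smt (verit) norm_ge_zero)
  then have nk: "norm k \<le> 1" by (simp add: k_def)
  have "(\<lambda>n. approx_unit k n * z) \<longlonglongrightarrow> z" for z
  proof -
    have "(\<lambda>n. (norm (z - approx_unit k n * z))\<^sup>2) \<longlonglongrightarrow> 0"
    proof (rule LIMSEQ_I)
      fix r :: real assume r: "0 < r"
      obtain t where t: "0 \<le> t" "nonneg (of_real (r/2) + t *\<^sub>R uembed h - uembed (z * star z))"
        using strictly_positive_dominates[OF assms, of "z * star z" "r/2"] r by (auto simp: star_simps)
      define s where "s = t * (norm h + 1)"
      have s: "0 \<le> s" using t by (simp add: s_def)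
      have "t *\<^sub>R uembed h = s *\<^sub>R uembed k"
        by (subst hk) (simp add: s_def uembed_simps)
      then have bound: "(norm (z - approx_unit k n * z))\<^sup>2 \<le> r/2 + s / (real n + 1)" for n
        using norm_minus_approx_unit_bound[OF k nk _ s, of "r/2" z n] t r by simp
      have "(\<lambda>n. s / (real n + 1)) \<longlonglongrightarrow> 0" by real_asymp
      then have "\<forall>\<^sub>F n in sequentially. s / (real n + 1) < r/2"
        by (rule order_tendstoD) (use r in simp)
      then obtain M where M: "\<And>n. n \<ge> M \<Longrightarrow> s / (real n + 1) < r/2"
        by (auto simp: eventually_sequentially)
      show "\<exists>no. \<forall>n\<ge>no. norm ((norm (z - approx_unit k n * z))\<^sup>2 - 0) < r"
      proof (intro exI allI impI)
        fix n assume "M \<le> n"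
        from M[OF this] bound[of n] have "(norm (z - approx_unit k n * z))\<^sup>2 < r" by linarith
        then show "norm ((norm (z - approx_unit k n * z))\<^sup>2 - 0) < r" by simp
      qed
    qed
    from tendsto_real_sqrt[OF this] have "(\<lambda>n. norm (z - approx_unit k n * z)) \<longlonglongrightarrow> 0"
      by simp
    then have "(\<lambda>n. z - approx_unit k n * z) \<longlonglongrightarrow> 0" by (rule tendsto_norm_zero_cancel)
    from tendsto_diff[OF tendsto_const[of z] this] show ?thesis by simp
  qed
  then show thesis by (rule that)
qed

section \<open>Units and the module Schur property\<close>

theorem unital_imp_module_schur:
  assumes "unital_algebra TYPE('a::cstar_algebra)"
  shows "module_schur_property (self_ip :: 'a \<Rightarrow> 'a \<Rightarrow> 'a)"
proof -
  obtain e :: 'a where e: "\<And>a. e * a = a" "\<And>a. a * e = a"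
    using assms by (auto simp: unital_algebra_def)
  have "star e * a = a" for a
    using arg_cong[OF e(2)[of "star a"], of star] by (simp add: star_simps)
  then show ?thesis
    by (auto simp: module_schur_property_def tau_convergent_def self_ip_def dest: spec[of _ e])
qed

theorem strictly_positive_module_schur_imp_unital:
  fixes h :: "'a::cstar_algebra"
  assumes h: "strictly_positive h" and schur: "module_schur_property (self_ip :: 'a \<Rightarrow> 'a \<Rightarrow> 'a)"
  shows "unital_algebra TYPE('a)"
proof -
  obtain e :: "nat \<Rightarrow> 'a" where e: "\<And>z. (\<lambda>n. e n * z) \<longlonglongrightarrow> z"
    using strictly_positive_approx_unit[OF h] by blast
  \<comment> \<open>\<open>self_ip\<close> multiplies by \<open>star z\<close> on the left, so the
    adjoints of the left approximate unit are tested: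
    \<open>star z * star (e n) = star (e n * z)\<close>.\<close>
  have "(\<lambda>n. star z * star (e n)) \<longlonglongrightarrow> star z" for z
    using bounded_linear.tendsto[OF bounded_linear_star e[of z]] by (simp add: star_mult)
  then have "tau_convergent self_ip (\<lambda>n. star (e n))"
    by (auto simp: tau_convergent_def self_ip_def convergent_def)
  then have "convergent (\<lambda>n. star (e n))"
    using schur by (auto simp: module_schur_property_def)
  then obtain u where u: "(\<lambda>n. star (e n)) \<longlonglongrightarrow> u" by (auto simp: convergent_def)
  from bounded_linear.tendsto[OF bounded_linear_star u] have "e \<longlonglongrightarrow> star u"
    by (simp add: star_star)
  then have 1: "star u * z = z" for z
    using LIMSEQ_unique[OF tendsto_mult_right e] by blast
  have 2: "z * u = z" for z
    using arg_cong[OF 1[of "star z"], of star] by (simp add: star_simps)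
  \<comment> \<open>\<open>star u * u\<close> is \<open>u\<close> because \<open>star u\<close> is a
    left unit, and \<open>star u\<close> because \<open>u\<close> is a right unit.\<close>
  from 1[of u] 2[of "star u"] have "star u = u" by simp
  with 1 2 show ?thesis by (auto simp: unital_algebra_def)
qed

section \<open>Separable algebras\<close>

lemma nonneg_uembed_sums:
  fixes a :: "nat \<Rightarrow> 'a::cstar_algebra"
  assumes "\<And>n. nonneg (uembed (a n))" "a sums s"
  shows "nonneg (uembed s)"
proof (rule nonneg_LIMSEQ)
  show "(\<lambda>n. uembed (\<Sum>i<n. a i)) \<longlonglongrightarrow> uembed s"
    using assms(2) by (auto simp: sums_def intro: bounded_linear.tendsto[OF bounded_linear_uembed])
  show "nonneg (uembed (\<Sum>i<n. a i))" for n
    using assms(1) nonneg_of_real[of 0]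
    by (induction n) (auto simp: uembed_simps intro: nonneg_add)
qed

lemma state_nonneg:
  assumes "state \<phi>" "nonneg (uembed a)"
  shows "\<phi> a \<in> \<real>\<^sub>\<ge>\<^sub>0"
  using assms nonneg_uembed_imp_positive_element by (auto simp: state_def)

lemma state_add: "state \<phi> \<Longrightarrow> \<phi> (a + b) = \<phi> a + \<phi> b"
  and state_scaleC: "state \<phi> \<Longrightarrow> \<phi> (c *\<^sub>C a) = c * \<phi> a"
  and bounded_linear_state: "state \<phi> \<Longrightarrow> bounded_linear \<phi>"
  by (auto simp: state_def bounded_clinear_functional_def bounded_linear.linear linear_add)

text \<open>If \<open>\<phi>\<close> vanished at all \<open>star d * d\<close>, polarization would
  make it vanish at all products, hence everywhere by \<open>left_factor_approx\<close>, against
  \<open>onorm \<phi> = 1\<close>.\<close>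

lemma state_nonzero_on_some_square:
  fixes \<phi> :: "'a::cstar_algebra \<Rightarrow> complex"
  assumes \<phi>: "state \<phi>"
  obtains d where "\<phi> (star d * d) \<noteq> 0"
proof (rule ccontr)
  assume "\<not> thesis"
  with that have zero: "\<phi> (star d * d) = 0" for d by blast
  have "\<phi> (star x * y) = 0" for x y
  proof -
    have s: "\<phi> (star x * y) + \<phi> (star y * x) = 0" for x y
      using zero[of "x + y"] zero[of x] zero[of y]
      by (simp add: star_add algebra_simps state_add[OF \<phi>])
    \<comment> \<open>Replacing \<open>y\<close> by \<open>\<i> y\<close> turns the sum of the cross
      terms into their difference.\<close>
    have "\<i> * \<phi> (star x * y) - \<i> * \<phi> (star y * x) = 0"
      using s[of x "\<i> *\<^sub>C y"] state_scaleC[OF \<phi>, of "- \<i>"]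
      by (simp add: star_scaleC mult_scaleC_left mult_scaleC_right state_scaleC[OF \<phi>])
    then have "\<phi> (star x * y) = \<phi> (star y * x)" by simp
    with s[of x y] show ?thesis by simp
  qed
  then have prod: "\<phi> (x * y) = 0" for x y
    by (metis star_star)
  have "\<phi> z = 0" for z
  proof -
    obtain e where "(\<lambda>n. e n * z) \<longlonglongrightarrow> z" by (rule left_factor_approx)
    from bounded_linear.tendsto[OF bounded_linear_state[OF \<phi>] this]
    have "(\<lambda>n. 0) \<longlonglongrightarrow> \<phi> z" by (simp add: prod)
    then show ?thesis by (simp add: LIMSEQ_const_iff)
  qed
  then have "\<phi> = (\<lambda>_. 0)" by auto
  then have "onorm \<phi> = 0" by (simp add: onorm_zero)
  with \<phi> show False by (simp add: state_def)
qed

text \<open>A state that is not positive at \<open>h\<close> vanishes at every summand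
  \<open>a m\<close>, because \<open>h - a m\<close> is positive too. It then vanishes at
  \<open>star x * x\<close> for \<open>x\<close> in a dense set, by continuity for all
  \<open>x\<close>, and no state does so.\<close>

theorem separable_imp_strictly_positive:
  assumes "separable_space (euclidean :: 'a::cstar_algebra topology)"
  shows "\<exists>h::'a. strictly_positive h"
proof -
  obtain C :: "'a set" where C: "countable C" "closure C = UNIV"
    using assms by (auto simp: separable_space_def)
  then have "C \<noteq> {}" by auto
  define d where "d = from_nat_into C"
  have d: "closure (range d) = UNIV"
    using C \<open>C \<noteq> {}\<close> by (simp add: d_def range_from_nat_into)
  \<comment> \<open>The weights give \<open>norm (a n) \<le> (1/2) ^ n\<close> however large the
    elements \<open>d n\<close> are.\<close>
  define c where "c n = (1/2) ^ n / (1 + (norm (d n))\<^sup>2)" for n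
  have c_pos: "c n > 0" for n
    by (simp add: c_def add_pos_nonneg)
  define a where "a n = c n *\<^sub>R (star (d n) * d n)" for n
  have a: "nonneg (uembed (a n))" for n
    using c_pos[of n] by (simp add: a_def uembed_simps(6) nonneg_scaleR nonneg_uembed_star_mult less_imp_le)
  have norm_a: "norm (a n) \<le> (1/2) ^ n" for n
  proof -
    have "(norm (d n))\<^sup>2 / (1 + (norm (d n))\<^sup>2) \<le> 1"
      by (simp add: divide_le_eq_1 add_pos_nonneg)
    then have "(1/2) ^ n * ((norm (d n))\<^sup>2 / (1 + (norm (d n))\<^sup>2)) \<le> (1/2::real) ^ n"
      by (intro mult_left_le) auto
    then show ?thesis
      using c_pos[of n] by (simp add: a_def norm_star_mult_self c_def)
  qed
  have "summable a"
    by (rule summable_comparison_test'[where g = "\<lambda>n. (1/2) ^ n" and N = 0])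
      (simp_all add: summable_geometric norm_a)
  then obtain h where h: "a sums h" by (auto simp: summable_def)
  have nh: "nonneg (uembed h)" by (rule nonneg_uembed_sums[OF a h])
  have h_minus: "nonneg (uembed (h - a m))" for m
  proof (rule nonneg_uembed_sums)
    show "(\<lambda>n. a n - (if n = m then a n else 0)) sums (h - a m)"
      by (intro sums_diff h sums_single)
    show "nonneg (uembed (a n - (if n = m then a n else 0)))" for n
      using a nonneg_of_real[where 'a = "'a unitization", of 0] by (simp add: uembed_simps(5))
  qed
  have "strictly_positive h"
    unfolding strictly_positive_def
  proof (intro conjI allI impI)
    show "positive_element h" by (rule nonneg_uembed_imp_positive_element[OF nh])
    fix \<phi> :: "'a \<Rightarrow> complex" assume \<phi>: "state \<phi>"
    show "0 < Re (\<phi> h)"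
    proof (rule ccontr)
      assume neg: "\<not> 0 < Re (\<phi> h)"
      have "\<phi> (star (d m) * d m) = 0" for m
      proof -
        have "\<phi> h = \<phi> (h - a m) + \<phi> (a m)" by (simp flip: state_add[OF \<phi>])
        moreover have "\<phi> (h - a m) \<in> \<real>\<^sub>\<ge>\<^sub>0" "\<phi> (a m) \<in> \<real>\<^sub>\<ge>\<^sub>0"
          by (intro state_nonneg[OF \<phi>] h_minus a)+
        ultimately have "\<phi> (a m) = 0"
          using neg by (auto simp: complex_nonneg_Reals_iff complex_eq_iff)
        then show ?thesis
          using c_pos[of m] by (simp add: a_def scaleR_scaleC state_scaleC[OF \<phi>])
      qed
      then have sub: "range d \<subseteq> {x. \<phi> (star x * x) = 0}" by auto
      have "continuous_on UNIV (\<lambda>x. \<phi> (star x * x))"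
        by (intro bounded_linear.continuous_on[OF bounded_linear_state[OF \<phi>]] continuous_on_mult
            bounded_linear.continuous_on[OF bounded_linear_star] continuous_on_id)
      then have "closed {x. \<phi> (star x * x) = 0}"
        by (intro closed_Collect_eq continuous_on_const)
      then have "closure (range d) \<subseteq> {x. \<phi> (star x * x) = 0}"
        using sub by (rule closure_minimal[rotated])
      then have "\<phi> (star x * x) = 0" for x using d by auto
      then show False using state_nonzero_on_some_square[OF \<phi>] by metis
    qed
  qed
  then show ?thesis by blast
qed

section \<open>The Schur property implies the module Schur property\<close>

lemma onorm_almost_attained:
  fixes f :: "'a::complex_normed_vector \<Rightarrow> complex"
  assumes f: "bounded_clinear_functional f" and \<delta>: "0 < \<delta>"
  obtains x where "norm x \<le> 1" "f x = complex_of_real (cmod (f x))" "onorm f - \<delta> \<le> cmod (f x)"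
proof -
  have lin: "bounded_linear f" and hom: "f (c *\<^sub>C x) = c * f x" for c x
    using f by (auto simp: bounded_clinear_functional_def)
  have f0: "f 0 = 0" by (rule linear_0[OF bounded_linear.linear[OF lin]])
  show thesis
  \<comment> \<open>A negative bound is met at 0. A nonnegative one is too small to be an operator
    bound for \<open>f\<close>, which yields \<open>y\<close>.\<close>
  proof (cases "onorm f - \<delta> < 0")
    case True
    then show thesis using that[of 0] by (simp add: f0)
  next
    case False
    have "\<exists>y. (onorm f - \<delta>) * norm y < cmod (f y)"
    proof (rule ccontr)
      assume "\<nexists>y. (onorm f - \<delta>) * norm y < cmod (f y)"
      then have "onorm f \<le> onorm f - \<delta>"
        using False by (intro onorm_bound) (auto simp: not_less)
      with \<delta> show False by simp
    qed
    then obtain y where y: "(onorm f - \<delta>) * norm y < cmod (f y)" by blast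
    then have "f y \<noteq> 0" using False
      by (auto simp: not_less mult_less_0_iff)
    then have "y \<noteq> 0" using f0 by auto
    \<comment> \<open>This factor scales \<open>y\<close> to norm 1 and rotates \<open>f y\<close>
      onto the positive axis.\<close>
    define c where "c = cnj (f y) / complex_of_real (cmod (f y) * norm y)"
    have "cmod c = 1 / norm y"
      using \<open>f y \<noteq> 0\<close> \<open>y \<noteq> 0\<close> by (simp add: c_def norm_divide norm_mult)
    then have 1: "norm (c *\<^sub>C y) \<le> 1" using \<open>y \<noteq> 0\<close> by (simp add: norm_scaleC)
    have "f (c *\<^sub>C y) = (f y * cnj (f y)) / complex_of_real (cmod (f y) * norm y)"
      by (simp add: hom c_def)
    also have "\<dots> = complex_of_real (cmod (f y) / norm y)"
      using \<open>f y \<noteq> 0\<close> \<open>y \<noteq> 0\<close>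
      by (simp add: complex_norm_square[symmetric] power2_eq_square divide_simps del: of_real_power)
    finally have 2: "f (c *\<^sub>C y) = complex_of_real (cmod (f y) / norm y)" .
    then have 3: "cmod (f (c *\<^sub>C y)) = cmod (f y) / norm y" by (simp add: norm_divide)
    show thesis
    proof (rule that[OF 1])
      show "f (c *\<^sub>C y) = complex_of_real (cmod (f (c *\<^sub>C y)))" by (metis 2 3)
      show "onorm f - \<delta> \<le> cmod (f (c *\<^sub>C y))"
        using y \<open>y \<noteq> 0\<close> by (simp add: 3 le_divide_eq less_imp_le)
    qed
  qed
qed

text \<open>The C*-identity expands the squared norm. The cross terms contribute at most
  \<open>2 \<theta> \<eta>\<close>, and \<open>1 + \<theta>\<^sup>2 + 2 \<theta> \<eta>\<close> is
  below the square of the claimed bound.\<close>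

lemma norm_add_almost_orthogonal:
  fixes x w :: "'a::cstar_algebra"
  assumes x: "norm x \<le> 1" and w: "norm w \<le> 1" and xw: "norm (star x * w) \<le> \<eta>" and \<theta>: "0 \<le> \<theta>"
  shows "norm (x + \<theta> *\<^sub>R w) \<le> 1 + \<theta> * \<eta> + \<theta>\<^sup>2 / 2"
proof (rule power2_le_imp_le)
  have \<eta>: "0 \<le> \<eta>" using xw norm_ge_zero order_trans by blast
  show "0 \<le> 1 + \<theta> * \<eta> + \<theta>\<^sup>2 / 2" using \<theta> \<eta> by simp
  have "star w * x = star (star x * w)" by (simp add: star_simps)
  then have wx: "norm (star w * x) \<le> \<eta>" using xw by (simp only: norm_star)
  have "(norm (x + \<theta> *\<^sub>R w))\<^sup>2 = norm (star (x + \<theta> *\<^sub>R w) * (x + \<theta> *\<^sub>R w))"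
    by (simp add: norm_star_mult_self)
  also have "star (x + \<theta> *\<^sub>R w) * (x + \<theta> *\<^sub>R w)
      = (star x * x + \<theta>\<^sup>2 *\<^sub>R (star w * w)) + (\<theta> *\<^sub>R (star x * w) + \<theta> *\<^sub>R (star w * x))"
    by (simp add: star_simps algebra_simps power2_eq_square)
  also have "norm \<dots> \<le> (1 + \<theta>\<^sup>2 * 1) + (\<theta> * \<eta> + \<theta> * \<eta>)"
    using x w xw wx \<theta>
    by (intro order_trans[OF norm_triangle_ineq] add_mono)
      (auto simp: norm_star_mult_self power_le_one mult_left_mono mult_left_le)
  also have "\<dots> \<le> (1 + \<theta> * \<eta> + \<theta>\<^sup>2 / 2)\<^sup>2"
  proof -
    have "(1 + \<theta> * \<eta> + \<theta>\<^sup>2 / 2)\<^sup>2 = 1 + 2 * (\<theta> * \<eta> + \<theta>\<^sup>2 / 2) + (\<theta> * \<eta> + \<theta>\<^sup>2 / 2)\<^sup>2"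
      by (simp add: power2_eq_square algebra_simps)
    then show ?thesis using zero_le_power2[of "\<theta> * \<eta> + \<theta>\<^sup>2 / 2"] by simp
  qed
  finally show "(norm (x + \<theta> *\<^sub>R w))\<^sup>2 \<le> (1 + \<theta> * \<eta> + \<theta>\<^sup>2 / 2)\<^sup>2" .
qed

text \<open>Let \<open>x\<close> almost attain the norm of \<open>f\<close>, and let \<open>e\<close> almost be a left unit for \<open>x\<close>. Then
  \<open>w = y - e y\<close> is almost orthogonal to \<open>x\<close>, so that
  \<open>|f x| + \<theta> |f w| \<le> \<parallel>f\<parallel> \<parallel>x + \<theta> w\<parallel> \<approx> \<parallel>f\<parallel> (1 + \<theta>\<^sup>2 / 2)\<close>, which forces \<open>f w\<close> to be small.\<close>

lemma functional_left_unit_approx: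
  fixes f :: "'a::cstar_algebra \<Rightarrow> complex"
  assumes f: "bounded_clinear_functional f" and \<epsilon>: "0 < \<epsilon>"
  obtains e where "\<And>y. cmod (f (y - e * y)) \<le> \<epsilon> * norm y"
proof -
  have lin: "bounded_linear f" and hom: "f (c *\<^sub>C x) = c * f x" for c x
    using f by (auto simp: bounded_clinear_functional_def)
  \<comment> \<open>The summand 1 keeps \<open>K\<close> positive when \<open>f\<close> is
    zero.\<close>
  define K where "K = onorm f + 1"
  have K: "0 < K" using onorm_pos_le[OF lin] by (simp add: K_def add_nonneg_pos)
  \<comment> \<open>The constants are balanced so that the final error
    \<open>\<delta> + K (\<theta> \<eta> + \<theta>\<^sup>2 / 2)\<close> is
    \<open>\<theta> \<epsilon>\<close>, split into a quarter, a quarter and a half.\<close>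
  define \<theta> where "\<theta> = \<epsilon> / K"
  have \<theta>: "0 < \<theta>" using \<epsilon> K by (simp add: \<theta>_def)
  define \<delta> where "\<delta> = \<theta> * \<epsilon> / 4"
  define \<eta> where "\<eta> = \<epsilon> / (4 * K)"
  have \<delta>: "0 < \<delta>" and \<eta>: "0 < \<eta>" using \<theta> \<epsilon> K by (simp_all add: \<delta>_def \<eta>_def)
  obtain x where x: "norm x \<le> 1" "f x = complex_of_real (cmod (f x))" "onorm f - \<delta> \<le> cmod (f x)"
    using onorm_almost_attained[OF f \<delta>] by blast
  define h where "h = x * star x"
  have h: "nonneg (uembed h)" "norm h \<le> 1"
    using nonneg_uembed_star_mult[of "star x"] x
    by (simp_all add: h_def star_star norm_mult_star_self power_le_one)
  obtain n where n: "1 / (real n + 1) < \<eta>\<^sup>2"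
  proof -
    have "(\<lambda>n. 1 / (real n + 1)) \<longlonglongrightarrow> 0" by real_asymp
    then have "\<forall>\<^sub>F n in sequentially. 1 / (real n + 1) < \<eta>\<^sup>2"
      by (rule order_tendstoD) (use \<eta> in simp)
    then show thesis using that by (auto simp: eventually_sequentially)
  qed
  define e where "e = approx_unit h n"
  have "(norm (x - e * x))\<^sup>2 \<le> \<eta>\<^sup>2"
    using norm_minus_approx_unit_self[OF x(1), of n] n by (simp add: e_def h_def)
  then have xe: "norm (x - e * x) \<le> \<eta>" using \<eta> by (rule_tac power2_le_imp_le) simp_all
  have bound: "cmod (f (y - e * y)) \<le> \<epsilon>" if y: "norm y \<le> 1" for y
  proof -
    define w where "w = y - e * y"
    have w: "norm w \<le> 1"
      unfolding w_def e_def using norm_minus_approx_unit_le[OF h] y by (rule order_trans)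
    \<comment> \<open>The self-adjoint factor \<open>(1 - h) ^ n\<close> moves from \<open>y\<close>
      over to \<open>x\<close>, on which it is small.\<close>
    have "uembed (star x * w) = star (uembed (x - e * x)) * uembed y"
      using one_minus_uembed_power(2)[OF h, of n]
      by (simp add: uembed_simps(4,8) w_def e_def uembed_minus_approx_unit star_mult mult.assoc)
    then have "norm (star x * w) \<le> norm (x - e * x) * norm y"
      by (metis norm_mult_ineq norm_star norm_uembed)
    also have "\<dots> \<le> \<eta> * 1" using xe y \<eta> by (intro mult_mono) auto
    finally have xw: "norm (star x * w) \<le> \<eta>" by simp
    \<comment> \<open>With this phase both \<open>f x\<close> and \<open>f (c w)\<close> are
      nonnegative reals, so their moduli add up.\<close>
    obtain c where c: "cmod c = 1" "c * f w = complex_of_real (cmod (f w))"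
    proof (cases "f w = 0")
      case False
      show thesis
        by (rule that[of "cnj (f w) / complex_of_real (cmod (f w))"])
          (use False in \<open>simp_all add: norm_divide complex_norm_square[symmetric] power2_eq_square
            mult.commute[of "cnj _"] del: of_real_power\<close>)
    qed (use that[of 1] in simp)
    have cw: "norm (c *\<^sub>C w) \<le> 1" "norm (star x * (c *\<^sub>C w)) \<le> \<eta>"
      using w xw c by (simp_all add: norm_scaleC mult_scaleC_right)
    have "f (x + \<theta> *\<^sub>R (c *\<^sub>C w)) = complex_of_real (cmod (f x) + \<theta> * cmod (f w))"
      using x(2) by (simp add: linear_add[OF bounded_linear.linear[OF lin]]
        linear_scale[OF bounded_linear.linear[OF lin]] hom c scaleR_conv_of_real)
    then have "cmod (f x) + \<theta> * cmod (f w) = cmod (f (x + \<theta> *\<^sub>R (c *\<^sub>C w)))"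
      using \<theta> by (simp only: norm_of_real) simp
    also have "\<dots> \<le> onorm f * norm (x + \<theta> *\<^sub>R (c *\<^sub>C w))" by (rule onorm[OF lin])
    also have "\<dots> \<le> onorm f * (1 + \<theta> * \<eta> + \<theta>\<^sup>2 / 2)"
      using norm_add_almost_orthogonal[OF x(1) cw] \<theta>
      by (intro mult_left_mono onorm_pos_le[OF lin]) simp
    also have "\<dots> = onorm f + onorm f * (\<theta> * \<eta> + \<theta>\<^sup>2 / 2)"
      by (simp add: algebra_simps)
    also have "\<dots> \<le> onorm f + K * (\<theta> * \<eta> + \<theta>\<^sup>2 / 2)"
      using \<theta> \<eta> by (intro add_left_mono mult_right_mono) (auto simp: K_def)
    finally have "\<theta> * cmod (f w) \<le> \<delta> + K * (\<theta> * \<eta> + \<theta>\<^sup>2 / 2)"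
      using x(3) by simp
    also have "\<dots> = \<theta> * \<epsilon>"
      using K by (simp add: \<delta>_def \<eta>_def \<theta>_def field_simps power2_eq_square)
    finally show ?thesis using \<theta> by (simp add: w_def)
  qed
  have "cmod (f (y - e * y)) \<le> \<epsilon> * norm y" for y
  proof (cases "y = 0")
    case True
    then show ?thesis by (simp add: linear_0[OF bounded_linear.linear[OF lin]])
  next
    case False
    define z where "z = (1 / norm y) *\<^sub>R y"
    have "y - e * y = norm y *\<^sub>R (z - e * z)"
      using False by (simp add: z_def scaleR_diff_right)
    then have "cmod (f (y - e * y)) = norm y * cmod (f (z - e * z))"
      by (simp add: linear_scale[OF bounded_linear.linear[OF lin]])
    also have "\<dots> \<le> norm y * \<epsilon>"
      using False by (intro mult_left_mono bound) (simp_all add: z_def)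
    finally show ?thesis by (simp add: mult.commute)
  qed
  then show thesis by (rule that)
qed

text \<open>A uniform boundedness argument: the closed sets \<open>F k\<close> cover the algebra, so
  by Baire one contains a ball, and differences carry its bound to a ball around 0.\<close>

lemma tau_convergent_bounded:
  fixes x :: "nat \<Rightarrow> 'a::cstar_algebra"
  assumes x: "tau_convergent self_ip x"
  obtains B where "0 \<le> B" "\<And>n. norm (x n) \<le> B"
proof -
  define F where "F k = {z. \<forall>n. norm (star z * x n) \<le> real k}" for k :: nat
  have "closed (F k)" for k
  proof -
    have "closed {z. norm (star z * x n) \<le> real k}" for n
      by (intro closed_Collect_le continuous_on_norm continuous_on_mult continuous_on_const
          bounded_linear.continuous_on[OF bounded_linear_star] continuous_on_id)
    then show ?thesis unfolding F_def by (rule closed_Collect_all)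
  qed
  moreover have "(\<Union>k. F k) = UNIV"
  proof -
    have "\<exists>k. z \<in> F k" for z
    proof -
      have "Bseq (\<lambda>n. star z * x n)"
        using x by (auto simp: tau_convergent_def self_ip_def intro: convergent_imp_Bseq)
      then obtain K where "\<And>n. norm (star z * x n) \<le> K" by (elim BseqE) blast
      moreover obtain k where "K \<le> real k" using real_arch_simple by blast
      ultimately show ?thesis unfolding F_def by (blast intro: order_trans)
    qed
    then show ?thesis by auto
  qed
  ultimately obtain k where "interior (F k) \<noteq> {}"
    using Baire_category_alt[of "euclidean :: 'a topology" "range F"]
      completely_metrizable_space_euclidean[where 'a = 'a]
    by auto
  then obtain z where "z \<in> interior (F k)" by blast
  then obtain r where r: "0 < r" "ball z r \<subseteq> F k"
    by (auto simp: mem_interior)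
  have bd: "norm (star y * x n) \<le> 2 * real k" if "norm y < r" for y n
  proof -
    have "z \<in> F k" "z + y \<in> F k" using r that by (auto simp: dist_norm)
    then have "norm (star (z + y) * x n) \<le> real k" "norm (star z * x n) \<le> real k"
      by (auto simp: F_def)
    then show ?thesis
      using norm_triangle_ineq4[of "star (z + y) * x n" "star z * x n"]
      by (simp add: star_add distrib_right)
  qed
  have "norm (x n) \<le> 4 * real k / r" for n
  proof (cases "x n = 0")
    case False
    \<comment> \<open>Testing \<open>x n\<close> against its own multiple of norm
      \<open>r / 2\<close> gives \<open>norm (star y * x n) = r * norm (x n) / 2\<close>.\<close>
    define y where "y = (r / (2 * norm (x n))) *\<^sub>R x n"
    have "norm y < r" using r False by (simp add: y_def)
    from bd[OF this, of n] have "r / (2 * norm (x n)) * (norm (x n))\<^sup>2 \<le> 2 * real k"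
      using r by (simp add: y_def star_scaleR norm_star_mult_self)
    then show ?thesis using r False by (simp add: field_simps power2_eq_square)
  qed (use r in simp)
  then show thesis using that[of "4 * real k / r"] r by simp
qed

text \<open>If \<open>x\<close> is not Cauchy, differences \<open>y k\<close> of arbitrarily late
  members stay at norm at least \<open>r\<close>, while \<open>e * y k\<close> tends to 0 for each
  \<open>e\<close>. Replacing \<open>f\<close> by \<open>f (e * z)\<close> up to a small multiple of
  the norm, with \<open>y\<close> bounded, shows that \<open>y\<close> is weakly null.\<close>

theorem schur_imp_module_schur:
  assumes schur: "schur_property TYPE('a::cstar_algebra)"
  shows "module_schur_property (self_ip :: 'a \<Rightarrow> 'a \<Rightarrow> 'a)"
  unfolding module_schur_property_def
proof (intro allI impI, rule ccontr)
  fix x :: "nat \<Rightarrow> 'a"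
  assume x: "tau_convergent self_ip x" and "\<not> convergent x"
  then have "\<not> Cauchy x" by (simp add: Cauchy_convergent_iff)
  then obtain r where r: "0 < r" "\<And>M. \<exists>m\<ge>M. \<exists>n\<ge>M. r \<le> dist (x m) (x n)"
    unfolding Cauchy_def by (meson not_less)
  then obtain p q where pq: "\<And>M. M \<le> p M" "\<And>M. M \<le> q M" "\<And>M. r \<le> dist (x (p M)) (x (q M))"
    by metis
  define y where "y k = x (p k) - x (q k)" for k
  obtain B where B: "0 \<le> B" "\<And>n. norm (x n) \<le> B"
    using tau_convergent_bounded[OF x] by blast
  have By: "norm (y k) \<le> 2 * B" for k
    using norm_triangle_ineq4[of "x (p k)" "x (q k)"] B(2)[of "p k"] B(2)[of "q k"] by (simp add: y_def)
  have pq_top: "filterlim p at_top sequentially" "filterlim q at_top sequentially"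
    using pq by (auto intro: filterlim_at_top_mono[OF filterlim_ident])
  have ey: "(\<lambda>k. e * y k) \<longlonglongrightarrow> 0" for e
  proof -
    have "convergent (\<lambda>n. e * x n)"
      using x by (auto simp: tau_convergent_def self_ip_def dest: spec[of _ "star e"] simp: star_star)
    then obtain l where l: "(\<lambda>n. e * x n) \<longlonglongrightarrow> l" by (auto simp: convergent_def)
    have "(\<lambda>k. e * x (p k) - e * x (q k)) \<longlonglongrightarrow> l - l"
      by (intro tendsto_diff filterlim_compose[OF l] pq_top)
    then show ?thesis by (simp add: y_def right_diff_distrib)
  qed
  have "weakly_tendsto y 0"
    unfolding weakly_tendsto_def
  proof (intro allI impI)
    fix f :: "'a \<Rightarrow> complex" assume f: "bounded_clinear_functional f"
    then have lin: "bounded_linear f" by (simp add: bounded_clinear_functional_def)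
    note fl = bounded_linear.linear[OF lin]
    have "(\<lambda>k. f (y k)) \<longlonglongrightarrow> 0"
    proof (rule LIMSEQ_I)
      fix s :: real assume s: "0 < s"
      \<comment> \<open>The summand 2 in the denominator covers \<open>B = 0\<close> and makes the
        estimate strict.\<close>
      define \<epsilon> where "\<epsilon> = s / (4 * B + 2)"
      have \<epsilon>: "0 < \<epsilon>" "\<epsilon> * (2 * B) < s / 2" using s B by (auto simp: \<epsilon>_def field_simps)
      obtain e where e: "\<And>z. cmod (f (z - e * z)) \<le> \<epsilon> * norm z"
        using functional_left_unit_approx[OF f \<epsilon>(1)] by blast
      have "(\<lambda>k. f (e * y k)) \<longlonglongrightarrow> f 0"
        by (rule bounded_linear.tendsto[OF lin ey])
      then have "(\<lambda>k. f (e * y k)) \<longlonglongrightarrow> 0" by (simp add: linear_0[OF fl])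
      then obtain M where M: "\<And>k. M \<le> k \<Longrightarrow> cmod (f (e * y k)) < s / 2"
        using LIMSEQ_D[of _ "0::complex" "s / 2"] s by auto
      show "\<exists>no. \<forall>n\<ge>no. norm (f (y n) - 0) < s"
      proof (intro exI allI impI)
        fix n assume "M \<le> n"
        have "cmod (f (y n)) = cmod (f (e * y n) + f (y n - e * y n))"
          by (simp flip: linear_add[OF fl])
        also have "\<dots> \<le> cmod (f (e * y n)) + cmod (f (y n - e * y n))" by (rule norm_triangle_ineq)
        also have "cmod (f (y n - e * y n)) \<le> \<epsilon> * (2 * B)"
          using e[of "y n"] By[of n] \<epsilon> by (meson less_imp_le mult_left_mono order_trans)
        finally show "norm (f (y n) - 0) < s" using M[OF \<open>M \<le> n\<close>] \<epsilon>(2) by simp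
      qed
    qed
    then show "(\<lambda>k. f (y k)) \<longlonglongrightarrow> f 0" by (simp add: linear_0[OF fl])
  qed
  then have "convergent y" using schur by (auto simp: schur_property_def)
  then obtain l where l: "y \<longlonglongrightarrow> l" by (auto simp: convergent_def)
  \<comment> \<open>\<open>schur_property\<close> only asserts that some norm limit exists;
    multiplying by \<open>star l\<close> shows it to be 0.\<close>
  have "star l * l = 0"
    using LIMSEQ_unique[OF tendsto_mult_left[OF l] ey] .
  then have "l = 0" by (simp add: star_mult_self_eq_0)
  have "r \<le> norm (y k)" for k using pq(3)[of k] by (simp add: y_def dist_norm)
  then have "r \<le> norm l" by (intro LIMSEQ_le_const[OF tendsto_norm[OF l]]) auto
  with \<open>l = 0\<close> r show False by simp
qed

section \<open>Bounded sequences\<close>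

lift_definition linfty_unit :: "nat \<Rightarrow> linfty" is "\<lambda>n k. if k = n then 1 else 0"
  by (rule bcontfun_normI[of _ 1]) auto

text \<open>Finite sums of the unit vectors with phases \<open>c n\<close> have norm at most 1, so
  the moduli \<open>cmod (f (linfty_unit n))\<close> are summable with sum at most
  \<open>onorm f\<close>. The unit vectors are therefore weakly null, yet distinct ones keep
  distance at least 1.\<close>

lemma not_schur_linfty: "\<not> schur_property TYPE(linfty)"
proof
  assume schur: "schur_property TYPE(linfty)"
  have "weakly_tendsto linfty_unit 0"
    unfolding weakly_tendsto_def
  proof (intro allI impI)
    fix f :: "linfty \<Rightarrow> complex" assume f: "bounded_clinear_functional f"
    then have lin: "bounded_linear f" and hom: "f (c *\<^sub>C x) = c * f x" for c x
      by (auto simp: bounded_clinear_functional_def)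
    define c where "c n = (if f (linfty_unit n) = 0 then 0
        else cnj (f (linfty_unit n)) / complex_of_real (cmod (f (linfty_unit n))))" for n
    have c: "cmod (c n) \<le> 1" "c n * f (linfty_unit n) = complex_of_real (cmod (f (linfty_unit n)))" for n
      by (auto simp: c_def norm_divide complex_norm_square[symmetric] power2_eq_square
          mult.commute[of "cnj _"] simp del: of_real_power)
    have "summable (\<lambda>n. cmod (f (linfty_unit n)))"
    proof (rule bounded_imp_summable)
      fix N
      define u where "u = (\<Sum>n\<le>N. c n *\<^sub>C linfty_unit n)"
      have "u k = (if k \<le> N then c k else 0)" for k
      proof -
        have "u k = (\<Sum>n\<le>N. (c n *\<^sub>C linfty_unit n) k)"
          unfolding u_def by (induction N) (simp_all add: plus_bcontfun.rep_eq)
        also have "\<dots> = (\<Sum>n\<le>N. if n = k then c k else 0)"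
          by (intro sum.cong) (auto simp: scaleC_bcontfun.rep_eq linfty_unit.rep_eq scaleC_complex_def)
        finally show ?thesis by simp
      qed
      then have "norm u \<le> 1" using c by (intro norm_bound) auto
      have "complex_of_real (\<Sum>n\<le>N. cmod (f (linfty_unit n))) = f u"
        by (simp add: u_def linear_sum[OF bounded_linear.linear[OF lin]] hom c)
      then have "(\<Sum>n\<le>N. cmod (f (linfty_unit n))) \<le> cmod (f u)"
        by (metis abs_ge_self norm_of_real)
      also have "\<dots> \<le> onorm f * norm u" by (rule onorm[OF lin])
      also have "\<dots> \<le> onorm f * 1"
        by (intro mult_left_mono onorm_pos_le[OF lin]) fact
      finally show "(\<Sum>n\<le>N. cmod (f (linfty_unit n))) \<le> onorm f" by simp
    qed simp
    then have "(\<lambda>n. f (linfty_unit n)) \<longlonglongrightarrow> 0"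
      by (rule tendsto_norm_zero_cancel[OF summable_LIMSEQ_zero])
    then show "(\<lambda>n. f (linfty_unit n)) \<longlonglongrightarrow> f 0"
      by (simp add: linear_0[OF bounded_linear.linear[OF lin]])
  qed
  then have "Cauchy linfty_unit"
    using schur by (auto simp: schur_property_def Cauchy_convergent_iff)
  then obtain M where M: "\<forall>m\<ge>M. \<forall>n\<ge>M. dist (linfty_unit m) (linfty_unit n) < 1"
    unfolding Cauchy_def by (meson zero_less_one)
  \<comment> \<open>Coordinate \<open>M\<close> tells two consecutive unit vectors apart.\<close>
  have "dist (linfty_unit M M) (linfty_unit (Suc M) M) \<le> dist (linfty_unit M) (linfty_unit (Suc M))"
    by (rule dist_bounded)
  then show False using M by (simp add: linfty_unit.rep_eq) (meson le_refl le_SucI not_less)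
qed

lemma unital_linfty: "unital_algebra TYPE(linfty)"
proof -
  have "\<forall>a. const_bcontfun 1 * a = a \<and> a * const_bcontfun 1 = (a :: linfty)"
    by (auto intro!: bcontfun_eqI simp: times_bcontfun.rep_eq const_bcontfun.rep_eq)
  then show ?thesis unfolding unital_algebra_def by blast
qed

text \<open>The last two conjuncts express \<open>strictly stronger\<close>: the bounded sequences
  refute the converse, being module Schur on account of their unit.\<close>

theorem theorem4p6:
  shows
    "((\<exists>h::'a::cstar_algebra. strictly_positive h) \<longrightarrow>
        (module_schur_property (self_ip :: 'a \<Rightarrow> 'a \<Rightarrow> 'a) \<longleftrightarrow> unital_algebra TYPE('a)))
     \<and> (separable_space (euclidean :: 'a topology) \<longrightarrow> (\<exists>h::'a. strictly_positive h))
     \<and> (schur_property TYPE('a) \<longrightarrow> module_schur_property (self_ip :: 'a \<Rightarrow> 'a \<Rightarrow> 'a))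
     \<and> (module_schur_property (self_ip :: linfty \<Rightarrow> linfty \<Rightarrow> linfty) \<and>
        \<not> schur_property TYPE(linfty))"
proof (intro conjI impI)
  assume "\<exists>h::'a. strictly_positive h"
  then show "module_schur_property (self_ip :: 'a \<Rightarrow> 'a \<Rightarrow> 'a) \<longleftrightarrow> unital_algebra TYPE('a)"
    using strictly_positive_module_schur_imp_unital unital_imp_module_schur by metis
qed (fact separable_imp_strictly_positive schur_imp_module_schur not_schur_linfty
    unital_imp_module_schur[OF unital_linfty])+

end
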